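(* Let $\mathbb{K}$ be an algebraically closed field, and let $r\geq 2$, $d\geq 3$ be integers such that at least one of the following holds: (1) $d$ is even; (2) $r$ is even and $d\geq r$; (3) $r$ is odd and $r\leq 5$. Suppose that property $C^d_m$ is true for all $m\leq \frac{r-1}{2}$. Then: (a) the Fano scheme $\mathbf{F}_k(X_{r,d})$ is one-split if and only if $k\geq \frac{r}{2}\cdot d$ (when $r$ is even), respectively $k\geq \frac{r-1}{2}\cdot d+1$ (when $r$ is odd); (b) if $r$ is even and $k\geq \frac{r}{2}\cdot d-1$, then the Fano scheme $\mathbf{F}_k(X_{r,d})$ is two-split.
   Context: $X_{r,d}=V\left(\sum_{i=1}^r\prod_{j=1}^d x_{ij}\right)\subset\mathbb{P}^{rd-1}$, where $x_{ij}$ ($1\le i\le r$, $1\le j\le d$) are the homogeneous coordinates on $\mathbb{P}^{rd-1}$ over $\mathbb{K}$. $\mathbf{F}_k(X)$ is the Fano scheme parametrizing projective $k$-planes ($k$-dimensional linear subspaces) contained in $X\subset \mathbb{P}^n$. Splitting: for an integer $\lambda\geq 1$, a $k$-plane $L\subset X_{r,d}$ admits a $\lambda$-splitting if there exist $1\leq a_1<\dots<a_\lambda\leq r$ such that $L\subset V\left(\sum_{i=1}^\lambda\prod_{j=1}^d x_{a_ij}\right)$. $\mathbf{F}_k(X_{r,d})$ is $m$-split if every $k$-plane contained in $X_{r,d}$ admits a $\lambda$-splitting for some $\lambda\leq m$ (one-split: $m=1$; two-split: $m=2$). Property $C^d_m$: consider equations of degree $d$ forms $\boldsymbol{\ell}_1+\dots+\boldsymbol{\ell}_m=\sum_{i=0}^m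 f_i\mathbf{x}_i$ in some polynomial ring over $\mathbb{K}$, where the $\mathbf{x}_i$ are pairwise coprime squarefree monomials, each $\boldsymbol{\ell}_i$ is a product of $d$ linear forms (possibly $0$), and each $f_i$ is a product of $d-\deg\mathbf{x}_i$ linear forms (possibly $0$; necessarily $0$ if $\deg \mathbf{x}_i>d$). $C^d_m$ is true if for every such equation satisfying $\deg\mathbf{x}_i+\deg\mathbf{x}_j\geq d+2$ for all $i\neq j$, there is some $i$ with $f_i=0$. *)

theory Defs
  imports
    Complex_Main
    "HOL-Library.Function_Algebras"
    "HOL-Library.Poly_Mapping"
    "HOL-Computational_Algebra.Polynomial"
begin

section \<open>Linear subspaces of projective space\<close>

definition scale_fun :: "'k::field \<Rightarrow> ('i \<Rightarrow> 'k) \<Rightarrow> 'i \<Rightarrow> 'k"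
  where "scale_fun c x = (\<lambda>p. c * x p)"

global_interpretation coord: vector_space "scale_fun :: 'k::field \<Rightarrow> ('i \<Rightarrow> 'k) \<Rightarrow> 'i \<Rightarrow> 'k"
  by unfold_locales (auto simp: scale_fun_def algebra_simps)

text \<open>The affine space \<open>K^(r d)\<close>, with coordinates \<open>x (i, j)\<close> for \<open>1 \<le> i \<le> r\<close>, \<open>1 \<le> j \<le> d\<close>;
  vectors are extended by \<open>0\<close> outside of the index set.\<close>

definition coord_space :: "nat \<Rightarrow> nat \<Rightarrow> (nat \<times> nat \<Rightarrow> 'k::field) set"
  where "coord_space r d = {x. \<forall>p. p \<notin> {1..r} \<times> {1..d} \<longrightarrow> x p = 0}"

text \<open>A point of projective space is the line spanned by a nonzero vector; \<open>projectivize\<close> sends a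
  cone in the affine space to the corresponding set of points. In particular the projective space
  itself is \<open>projectivize (coord_space r d)\<close>.\<close>

definition projectivize :: "('i \<Rightarrow> 'k::field) set \<Rightarrow> ('i \<Rightarrow> 'k) set set"
  where "projectivize W = (\<lambda>x. coord.span {x}) ` (W - {0})"

definition proj_plane :: "nat \<Rightarrow> nat \<Rightarrow> nat \<Rightarrow> (nat \<times> nat \<Rightarrow> 'k::field) set set \<Rightarrow> bool"
  where "proj_plane r d k L \<longleftrightarrow>
    (\<exists>W \<subseteq> coord_space r d. coord.subspace W \<and> coord.dim W = k + 1 \<and> L = projectivize W)"


section \<open>The hypersurfaces and their Fano schemes\<close>

text \<open>\<open>sum_prod_locus r d A\<close> is the hypersurface \<open>V (\<Sum>i\<in>A. \<Prod>j. x_ij)\<close> in \<open>P^(r d - 1)\<close>;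
  \<open>X_{r,d}\<close> is the case \<open>A = {1..r}\<close>.\<close>

definition sum_prod_locus :: "nat \<Rightarrow> nat \<Rightarrow> nat set \<Rightarrow> (nat \<times> nat \<Rightarrow> 'k::field) set set"
  where "sum_prod_locus r d A =
    projectivize {x \<in> coord_space r d. (\<Sum>i\<in>A. \<Prod>j=1..d. x (i, j)) = 0}"

definition X_hyp :: "nat \<Rightarrow> nat \<Rightarrow> (nat \<times> nat \<Rightarrow> 'k::field) set set"
  where "X_hyp r d = sum_prod_locus r d {1..r}"

text \<open>The closed points of the Fano scheme; splitting only depends on these.\<close>

definition fano_planes :: "nat \<Rightarrow> nat \<Rightarrow> nat \<Rightarrow> (nat \<times> nat \<Rightarrow> 'k::field) set set set"
  where "fano_planes r d k = {L. proj_plane r d k L \<and> L \<subseteq> X_hyp r d}"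

text \<open>The indices \<open>a_1 < \<dots> < a_l\<close> are recorded by the set \<open>A\<close> they form.\<close>

definition admits_splitting ::
    "nat \<Rightarrow> nat \<Rightarrow> nat \<Rightarrow> (nat \<times> nat \<Rightarrow> 'k::field) set set \<Rightarrow> bool"
  where "admits_splitting r d l L \<longleftrightarrow>
    l \<ge> 1 \<and> (\<exists>A \<subseteq> {1..r}. card A = l \<and> L \<subseteq> sum_prod_locus r d A)"

definition fano_split :: "'k::field itself \<Rightarrow> nat \<Rightarrow> nat \<Rightarrow> nat \<Rightarrow> nat \<Rightarrow> bool"
  where "fano_split _ r d k m \<longleftrightarrow>
    (\<forall>L \<in> (fano_planes r d k :: (nat \<times> nat \<Rightarrow> 'k) set set set).
       \<exists>l \<le> m. admits_splitting r d l L)"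


section \<open>Property C\<close>

text \<open>Polynomials in the variables \<open>y_0, y_1, \<dots>\<close>, as finitely supported maps from exponent vectors
  to coefficients. The polynomial ring \<open>K[y_0, \<dots>, y_(n-1)]\<close> is the subring in which only
  variables of index less than \<open>n\<close> occur.\<close>

type_synonym monom = "nat \<Rightarrow>\<^sub>0 nat"
type_synonym 'k mpoly = "monom \<Rightarrow>\<^sub>0 'k"

definition monom_poly :: "monom \<Rightarrow> 'k::field mpoly"
  where "monom_poly e = Poly_Mapping.single e 1"

definition deg_monom :: "monom \<Rightarrow> nat"
  where "deg_monom e = (\<Sum>v\<in>Poly_Mapping.keys e. Poly_Mapping.lookup e v)"

definition squarefree_monom :: "monom \<Rightarrow> bool"
  where "squarefree_monom e \<longleftrightarrow> (\<forall>v. Poly_Mapping.lookup e v \<le> 1)"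

definition coprime_monom :: "monom \<Rightarrow> monom \<Rightarrow> bool"
  where "coprime_monom e e' \<longleftrightarrow> Poly_Mapping.keys e \<inter> Poly_Mapping.keys e' = {}"

definition linear_form :: "nat \<Rightarrow> 'k::field mpoly \<Rightarrow> bool"
  where "linear_form n p \<longleftrightarrow>
    (\<exists>c. p = (\<Sum>v<n. Poly_Mapping.single (Poly_Mapping.single v 1) (c v)))"

text \<open>``A product of \<open>e\<close> linear forms, possibly \<open>0\<close>''. For \<open>e > 0\<close> the disjunct \<open>p = 0\<close> is
  redundant; for \<open>e = 0\<close> the product is empty and \<open>p\<close> is \<open>0\<close> or \<open>1\<close>.\<close>

definition lin_prod :: "nat \<Rightarrow> nat \<Rightarrow> 'k::field mpoly \<Rightarrow> bool"
  where "lin_prod n e p \<longleftrightarrow>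
    p = 0 \<or> (\<exists>h. (\<forall>j<e. linear_form n (h j)) \<and> p = (\<Prod>j<e. h j))"

text \<open>Allowing arbitrary constants \<open>f i\<close> when \<open>deg x_i = d\<close> gives an equivalent property for
  \<open>d > 0\<close>: a nonzero constant is absorbed by rescaling a variable of \<open>x_i\<close>, which by coprimality
  occurs in no other \<open>x_j\<close>.\<close>

definition property_C :: "'k::field itself \<Rightarrow> nat \<Rightarrow> nat \<Rightarrow> bool"
  where "property_C _ d m \<longleftrightarrow>
    (\<forall>n (x :: nat \<Rightarrow> monom) (l :: nat \<Rightarrow> 'k mpoly) (f :: nat \<Rightarrow> 'k mpoly).
       (\<forall>i\<le>m. Poly_Mapping.keys (x i) \<subseteq> {..<n} \<and> squarefree_monom (x i)) \<longrightarrow>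
       (\<forall>i\<le>m. \<forall>j\<le>m. i \<noteq> j \<longrightarrow> coprime_monom (x i) (x j)) \<longrightarrow>
       (\<forall>i\<in>{1..m}. lin_prod n d (l i)) \<longrightarrow>
       (\<forall>i\<le>m. if deg_monom (x i) \<le> d then lin_prod n (d - deg_monom (x i)) (f i) else f i = 0) \<longrightarrow>
       (\<Sum>i=1..m. l i) = (\<Sum>i=0..m. f i * monom_poly (x i)) \<longrightarrow>
       (\<forall>i\<le>m. \<forall>j\<le>m. i \<noteq> j \<longrightarrow> deg_monom (x i) + deg_monom (x j) \<ge> d + 2) \<longrightarrow>
       (\<exists>i\<le>m. f i = 0))"

end

theory Submission
  imports Defs
begin

text \<open>
  Let \<open>W\<close> be the linear space of a plane that is not one-split. Arrange the rows of coordinates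
  greedily: repeatedly choose the row that contributes the largest set of coordinates independent
  of those already chosen. This gives a coordinate basis of \<open>W\<close> with \<open>b\<^sub>0 \<ge> b\<^sub>1 \<ge> \<dots>\<close> coordinates in
  the successive rows, and each row depends only on the blocks up to its own. If
  exactly \<open>t\<close> of the \<open>b\<^sub>i\<close> are positive, then setting to \<open>0\<close> the blocks of the rows after the first
  \<open>r - t + 1\<close> kills all but these first rows, which become \<open>f\<^sub>i x\<^sub>i\<close> with \<open>x\<^sub>i\<close> the product of the
  \<open>i\<close>-th block, and the last \<open>r - t\<close> rows. As no \<open>f\<^sub>i\<close> vanishes, property C bounds \<open>b\<^sub>i + b\<^sub>j\<close> by
  \<open>d + 1\<close> for some pair, hence bounds the dimension of \<open>W\<close>. One numerical case escapes: \<open>r = 5\<close> and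
  four blocks of size \<open>(d + 1) / 2\<close>; there a product of linear forms would be the sum of two
  products in disjoint variables, which is impossible. In the extremal case for even \<open>r\<close>, half of
  the rows are bases; property C on the hyperplanes \<open>x\<^sub>p = 0\<close> shows that every other coordinate is
  proportional to a basis coordinate, so that the remaining rows cancel them one by one.
\<close>

section \<open>Vanishing of polynomial functions\<close>

text \<open>In a finite field the product of all X - a, plus 1, takes the value 1 everywhere
  although its degree is positive.\<close>

lemma infinite_alg_closed_field: "infinite (UNIV :: 'k::alg_closed_field set)"
proof
  assume fin: "finite (UNIV :: 'k set)"
  define p :: "'k poly" where "p = (\<Prod>a\<in>UNIV. [:- a, 1:]) + 1"
  have deg: "degree (\<Prod>a\<in>(UNIV :: 'k set). [:- a, 1:]) = card (UNIV :: 'k set)"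
    by (subst degree_prod_eq_sum_degree) auto
  have "card (UNIV :: 'k set) > 0"
    using fin by (simp add: card_gt_0_iff)
  then have "degree p > 0"
    unfolding p_def by (subst degree_add_eq_left) (simp_all add: deg)
  then obtain x where "poly p x = 0"
    using alg_closed_imp_poly_has_root by blast
  moreover have "poly (\<Prod>a\<in>(UNIV :: 'k set). [:- a, 1:]) x = 0"
    using fin by (auto simp: poly_prod prod_zero_iff)
  ultimately show False
    by (simp add: p_def)
qed

text \<open>Independence of characters after Dedekind and Artin. Subtracting \<open>X s g\<close>
  times the relation at \<open>c\<close> from the relation at \<open>g\<close> times
  \<open>c\<close> eliminates \<open>s\<close>; for a given \<open>e\<close>, the point
  \<open>g\<close> is chosen such that the new factor \<open>X e g - X s g\<close> is
  nonzero.\<close>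

lemma multiplicative_functions_independent:
  fixes X :: "'e \<Rightarrow> ('x \<Rightarrow> 'k::field) \<Rightarrow> 'k"
  assumes "finite S"
    and mult: "\<And>e c c'. X e (\<lambda>v. c v * c' v) = X e c * X e c'"
    and one: "\<And>e. X e (\<lambda>_. 1) = 1"
    and dist: "\<And>e e'. e \<noteq> e' \<Longrightarrow> \<exists>c. X e c \<noteq> X e' c"
    and "\<And>c. (\<Sum>e\<in>S. a e * X e c) = 0"
  shows "\<forall>e\<in>S. a e = 0"
  using \<open>finite S\<close> \<open>\<And>c. (\<Sum>e\<in>S. a e * X e c) = 0\<close>
proof (induction S arbitrary: a)
  case empty
  then show ?case by simp
next
  case (insert s S)
  have S0: "a e = 0" if "e \<in> S" for e
  proof -
    from that insert.hyps have "e \<noteq> s" by auto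
    then obtain g where g: "X e g \<noteq> X s g" using dist by blast
    have "(\<Sum>e\<in>S. (a e * (X e g - X s g)) * X e c) = 0" for c
    proof -
      have "(\<Sum>e\<in>S. (a e * (X e g - X s g)) * X e c)
          = (\<Sum>e\<in>insert s S. (a e * (X e g - X s g)) * X e c)"
        using insert.hyps by simp
      also have "\<dots> = (\<Sum>e\<in>insert s S. a e * X e (\<lambda>v. g v * c v))
          - X s g * (\<Sum>e\<in>insert s S. a e * X e c)"
        by (simp only: mult sum_distrib_left sum_subtractf [symmetric]) (simp add: algebra_simps)
      finally show ?thesis using insert.prems by simp
    qed
    then have "\<forall>e\<in>S. a e * (X e g - X s g) = 0"
      by (rule insert.IH)
    with that g show ?thesis by auto
  qed
  with insert.prems[of "\<lambda>_. 1"] insert.hyps have "a s = 0"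
    by (simp add: one)
  with S0 show ?case by auto
qed

section \<open>Evaluation of polynomials at points\<close>

definition eval_monom :: "(nat \<Rightarrow> 'k::field) \<Rightarrow> monom \<Rightarrow> 'k"
  where "eval_monom c e = (\<Prod>v\<in>Poly_Mapping.keys e. c v ^ Poly_Mapping.lookup e v)"

definition eval_mpoly :: "(nat \<Rightarrow> 'k::field) \<Rightarrow> 'k mpoly \<Rightarrow> 'k"
  where "eval_mpoly c p = (\<Sum>e\<in>Poly_Mapping.keys p. Poly_Mapping.lookup p e * eval_monom c e)"

lemma eval_monom_superset:
  assumes "finite V" "Poly_Mapping.keys e \<subseteq> V"
  shows "eval_monom c e = (\<Prod>v\<in>V. c v ^ Poly_Mapping.lookup e v)"
  unfolding eval_monom_def using assms
  by (intro prod.mono_neutral_left) (auto simp: in_keys_iff)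

lemma eval_monom_add: "eval_monom c (e + e') = eval_monom c e * eval_monom c e'"
proof -
  let ?V = "Poly_Mapping.keys e \<union> Poly_Mapping.keys e'"
  have "eval_monom c (e + e') = (\<Prod>v\<in>?V. c v ^ Poly_Mapping.lookup (e + e') v)"
    by (rule eval_monom_superset) (auto dest: subsetD[OF Poly_Mapping.keys_add])
  also have "\<dots> = (\<Prod>v\<in>?V. c v ^ Poly_Mapping.lookup e v) * (\<Prod>v\<in>?V. c v ^ Poly_Mapping.lookup e' v)"
    by (simp add: lookup_add power_add prod.distrib)
  also have "\<dots> = eval_monom c e * eval_monom c e'"
    by (simp add: eval_monom_superset[of ?V])
  finally show ?thesis .
qed

lemma eval_monom_0 [simp]: "eval_monom c 0 = 1"
  by (simp add: eval_monom_def)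

lemma eval_mpoly_0 [simp]: "eval_mpoly c 0 = 0"
  by (simp add: eval_mpoly_def)

lemma eval_mpoly_single [simp]: "eval_mpoly c (Poly_Mapping.single e a) = a * eval_monom c e"
  by (simp add: eval_mpoly_def)

lemma eval_mpoly_1 [simp]: "eval_mpoly c 1 = 1"
  using eval_mpoly_single[of c 0 1] by simp

lemma eval_mpoly_add [simp]: "eval_mpoly c (p + q) = eval_mpoly c p + eval_mpoly c q"
  unfolding eval_mpoly_def
  by (rule setsum_keys_plus_distrib) (auto simp: algebra_simps)

lemma eval_mpoly_sum [simp]: "eval_mpoly c (\<Sum>i\<in>A. p i) = (\<Sum>i\<in>A. eval_mpoly c (p i))"
  by (induction A rule: infinite_finite_induct) auto

lemma mpoly_eq_sum_single:
  "p = (\<Sum>e\<in>Poly_Mapping.keys p. Poly_Mapping.single e (Poly_Mapping.lookup p e))"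
  by (rule poly_mapping_eqI)
    (auto simp: lookup_sum lookup_single when_def in_keys_iff sum.delta' split: if_splits)

lemma eval_mpoly_mult [simp]: "eval_mpoly c (p * q) = eval_mpoly c p * eval_mpoly c q"
proof -
  have "p * q = (\<Sum>e\<in>Poly_Mapping.keys p. \<Sum>e'\<in>Poly_Mapping.keys q.
      Poly_Mapping.single (e + e') (Poly_Mapping.lookup p e * Poly_Mapping.lookup q e'))"
    by (subst mpoly_eq_sum_single[of p], subst mpoly_eq_sum_single[of q])
      (simp add: sum_product mult_single)
  then show ?thesis
    unfolding eval_mpoly_def[of c p] eval_mpoly_def[of c q]
    by (simp add: sum_product eval_monom_add mult_ac)
qed

lemma eval_mpoly_prod [simp]: "eval_mpoly c (\<Prod>i\<in>A. p i) = (\<Prod>i\<in>A. eval_mpoly c (p i))"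
  by (induction A rule: infinite_finite_induct) auto

lemma eval_mpoly_uminus [simp]: "eval_mpoly c (- p) = - eval_mpoly c p"
  using eval_mpoly_add[of c p "- p"] by (simp add: eq_neg_iff_add_eq_0 add.commute)

lemma eval_mpoly_diff [simp]: "eval_mpoly c (p - q) = eval_mpoly c p - eval_mpoly c q"
  using eval_mpoly_add[of c p "- q"] by simp

lemma infinite_field_ex_power_neq:
  assumes "infinite (UNIV :: 'k::field set)" "a \<noteq> b"
  shows "\<exists>z :: 'k. z ^ a \<noteq> z ^ b"
proof (rule ccontr)
  assume *: "\<nexists>z :: 'k. z ^ a \<noteq> z ^ b"
  define p :: "'k poly" where "p = monom 1 a - monom 1 b"
  have "coeff p a = 1" using \<open>a \<noteq> b\<close> by (simp add: p_def)
  then have "p \<noteq> 0" by auto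
  then have "finite {z. poly p z = 0}" by (rule poly_roots_finite)
  moreover have "poly p z = 0" for z
    using * by (simp add: p_def poly_monom)
  ultimately show False using assms by simp
qed

text \<open>Monomials are multiplicative functions of the point, pairwise distinct because the field
  is infinite, so independence of characters kills all coefficients.\<close>

lemma mpoly_eq_0_if_eval_0:
  fixes p :: "'k::field mpoly"
  assumes inf: "infinite (UNIV :: 'k set)" and "\<And>c. eval_mpoly c p = 0"
  shows "p = 0"
proof -
  have "\<forall>e\<in>Poly_Mapping.keys p. Poly_Mapping.lookup p e = 0"
  proof (rule multiplicative_functions_independent[where X = "\<lambda>e (c :: nat \<Rightarrow> 'k). eval_monom c e"])
    show "eval_monom (\<lambda>v. c v * c' v) e = eval_monom c e * eval_monom c' e"
      for e and c c' :: "nat \<Rightarrow> 'k"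
      by (simp add: eval_monom_def power_mult_distrib prod.distrib)
    show "eval_monom (\<lambda>_. 1 :: 'k) e = 1" for e
      by (simp add: eval_monom_def)
    show "\<exists>c :: nat \<Rightarrow> 'k. eval_monom c e \<noteq> eval_monom c e'" if "e \<noteq> e'" for e e'
    proof -
      from that obtain v where v: "Poly_Mapping.lookup e v \<noteq> Poly_Mapping.lookup e' v"
        by (meson poly_mapping_eqI)
      obtain z :: 'k where z: "z ^ Poly_Mapping.lookup e v \<noteq> z ^ Poly_Mapping.lookup e' v"
        using infinite_field_ex_power_neq[OF inf v] by blast
      \<comment> \<open>Coordinates equal to 1 away from \<open>v\<close> isolate the exponent of
        \<open>v\<close>.\<close>
      let ?c = "\<lambda>u. if u = v then z else 1"
      have "eval_monom ?c e = z ^ Poly_Mapping.lookup e v" for e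
        by (subst eval_monom_superset[of "insert v (Poly_Mapping.keys e)"])
          (auto simp: prod.insert_remove intro!: prod.neutral)
      with z show ?thesis by (intro exI[of _ ?c]) simp
    qed
    show "(\<Sum>e\<in>Poly_Mapping.keys p. Poly_Mapping.lookup p e * eval_monom c e) = 0" for c
      using assms(2)[of c] by (simp add: eval_mpoly_def)
  qed auto
  then show ?thesis
    by (intro poly_mapping_eqI) (auto simp: in_keys_iff)
qed

section \<open>Property C for products of functionals\<close>

definition form_poly :: "nat \<Rightarrow> (nat \<Rightarrow> 'k::field) \<Rightarrow> 'k mpoly"
  where "form_poly n c = (\<Sum>v<n. Poly_Mapping.single (Poly_Mapping.single v 1) (c v))"

definition set_monom :: "nat set \<Rightarrow> monom"
  where "set_monom V = (\<Sum>v\<in>V. Poly_Mapping.single v 1)"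

lemma linear_form_form_poly: "linear_form n (form_poly n c)"
  unfolding linear_form_def form_poly_def by blast

lemma eval_form_poly [simp]: "eval_mpoly x (form_poly n c) = (\<Sum>v<n. c v * x v)"
  by (simp add: form_poly_def eval_monom_def)

lemma lookup_set_monom: "finite V \<Longrightarrow> Poly_Mapping.lookup (set_monom V) v = (if v \<in> V then 1 else 0)"
  by (simp add: set_monom_def lookup_sum lookup_single when_def)

lemma keys_set_monom: "finite V \<Longrightarrow> Poly_Mapping.keys (set_monom V) = V"
  by (auto simp: in_keys_iff lookup_set_monom split: if_splits)

lemma deg_set_monom: "finite V \<Longrightarrow> deg_monom (set_monom V) = card V"
  by (simp add: deg_monom_def keys_set_monom lookup_set_monom)

lemma eval_set_monom: "finite V \<Longrightarrow> eval_monom x (set_monom V) = (\<Prod>v\<in>V. x v)"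
  by (simp add: eval_monom_def keys_set_monom lookup_set_monom)

lemma lin_prod_prod:
  assumes "finite S" "\<And>p. p \<in> S \<Longrightarrow> linear_form n (Y p)"
  shows "lin_prod n (card S) (\<Prod>p\<in>S. Y p)"
proof -
  obtain h where h: "bij_betw h {..<card S} S"
    using ex_bij_betw_nat_finite[OF assms(1)] by (auto simp: atLeast0LessThan)
  have "(\<Prod>p\<in>S. Y p) = (\<Prod>j<card S. Y (h j))"
    by (rule prod.reindex_bij_betw [OF h, symmetric])
  moreover have "\<forall>j<card S. linear_form n (Y (h j))"
    using h assms(2) by (auto simp: bij_betw_def)
  ultimately show ?thesis
    unfolding lin_prod_def by (intro disjI2 exI[of _ "\<lambda>j. Y (h j)"] conjI)
qed

text \<open>The sign is absorbed by the last factor; for \<open>e = 0\<close> there is none.\<close>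

lemma lin_prod_uminus:
  assumes "lin_prod n e p" "e > 0"
  shows "lin_prod n e (- p)"
proof (cases "p = 0")
  case False
  then obtain h where h: "\<forall>j<e. linear_form n (h j)" "p = (\<Prod>j<e. h j)"
    using assms by (auto simp: lin_prod_def)
  obtain e' where e: "e = Suc e'" using assms by (cases e) auto
  let ?h = "h(e' := - h e')"
  from h(1) e obtain c where "h e' = (\<Sum>v<n. Poly_Mapping.single (Poly_Mapping.single v 1) (c v))"
    by (auto simp: linear_form_def)
  then have "linear_form n (- h e')"
    unfolding linear_form_def
    by (intro exI[of _ "\<lambda>v. - c v"]) (simp only: single_uminus sum_negf)
  with h(1) have "\<forall>j<e. linear_form n (?h j)"
    by simp
  moreover have "(\<Prod>j<e'. ?h j) = (\<Prod>j<e'. h j)"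
    by (intro prod.cong) auto
  then have "- p = (\<Prod>j<e. ?h j)"
    by (simp add: h(2) e)
  ultimately show ?thesis
    unfolding lin_prod_def by (intro disjI2 exI[of _ ?h] conjI)
qed (simp add: lin_prod_def)

text \<open>Property C for arbitrary index sets and for an identity of functions on K^Q:
  \<open>p\<close> stands for the functional with coefficients \<open>a p\<close>, and the elements
  of \<open>T i\<close> are variables. Over an infinite field the identity of functions is one of
  polynomials, and a product of forms vanishes only if one of the forms does.\<close>

lemma property_C_forms:
  fixes a :: "'p \<Rightarrow> 'q \<Rightarrow> 'k::field"
  assumes C: "property_C TYPE('k) d m" and inf: "infinite (UNIV :: 'k set)" and d: "d > 0"
    and Q: "finite Q" and A: "card A = Suc m" and L: "finite L" "card L = m"
    and G: "\<And>i. i \<in> L \<Longrightarrow> finite (G i) \<and> card (G i) = d"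
    and S: "\<And>i. i \<in> A \<Longrightarrow> finite (S i) \<and> T i \<subseteq> Q \<and> card (S i) + card (T i) = d"
    and disj: "\<And>i j. i \<in> A \<Longrightarrow> j \<in> A \<Longrightarrow> i \<noteq> j \<Longrightarrow> T i \<inter> T j = {}"
    and deg: "\<And>i j. i \<in> A \<Longrightarrow> j \<in> A \<Longrightarrow> i \<noteq> j \<Longrightarrow> card (T i) + card (T j) \<ge> d + 2"
    and zero: "\<And>c. (\<Sum>i\<in>L. \<Prod>p\<in>G i. \<Sum>q\<in>Q. a p q * c q)
        + (\<Sum>i\<in>A. (\<Prod>p\<in>S i. \<Sum>q\<in>Q. a p q * c q) * (\<Prod>q\<in>T i. c q)) = 0"
  shows "\<exists>i\<in>A. \<exists>p\<in>S i. \<forall>q\<in>Q. a p q = 0"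
proof -
  define n where "n = card Q"
  obtain e where e: "bij_betw e {..<n} Q"
    using ex_bij_betw_nat_finite[OF Q] by (auto simp: n_def atLeast0LessThan)
  have "finite A" by (rule card_ge_0_finite) (simp add: A)
  then obtain \<alpha> where \<alpha>: "bij_betw \<alpha> {0..m} A"
    using ex_bij_betw_nat_finite[of A] A by (auto simp: atLeastLessThanSuc_atLeastAtMost)
  obtain \<beta> where \<beta>: "bij_betw \<beta> {1..m} L"
    using ex_bij_betw_nat_finite_1[OF L(1)] L(2) by auto
  have \<alpha>A: "\<alpha> i \<in> A" if "i \<le> m" for i using \<alpha> that by (auto simp: bij_betw_def)
  have \<alpha>_neq: "\<alpha> i \<noteq> \<alpha> j" if "i \<le> m" "j \<le> m" "i \<noteq> j" for i j
    using \<alpha> that by (auto simp: bij_betw_def inj_on_def)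
  have \<beta>L: "\<beta> i \<in> L" if "i \<in> {1..m}" for i using \<beta> that by (auto simp: bij_betw_def)
  define Y where "Y p = form_poly n (\<lambda>v. a p (e v))" for p
  define V where "V i = {v. v < n \<and> e v \<in> T (\<alpha> i)}" for i
  have finV [simp]: "finite (V i)" for i by (auto simp: V_def)
  have eV: "bij_betw e (V i) (T (\<alpha> i))" if "i \<le> m" for i
  proof (rule bij_betw_subset[OF e])
    have "T (\<alpha> i) \<subseteq> e ` {..<n}"
      using S \<alpha>A[OF that] bij_betw_imp_surj_on[OF e] by blast
    then show "e ` V i = T (\<alpha> i)"
      unfolding V_def by blast
  qed (auto simp: V_def)
  have cardV: "card (V i) = card (T (\<alpha> i))" if "i \<le> m" for i
    using eV[OF that] by (rule bij_betw_same_card)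
  \<comment> \<open>In \<open>zero\<close> the products over \<open>G\<close> stand on the same side
    as the others, in property C on the opposite one; as \<open>d > 0\<close> the sign can be
    absorbed.\<close>
  define l where "l i = - (\<Prod>p\<in>G (\<beta> i). Y p)" for i
  define f where "f i = (\<Prod>p\<in>S (\<alpha> i). Y p)" for i
  define x where "x i = set_monom (V i)" for i
  have Ylin: "linear_form n (Y p)" for p by (simp add: Y_def linear_form_form_poly)
  have "(\<Sum>i=0..m. f i * monom_poly (x i)) - (\<Sum>i=1..m. l i) = 0"
  proof (rule mpoly_eq_0_if_eval_0[OF inf])
    fix x' :: "nat \<Rightarrow> 'k"
    define c where "c q = x' (inv_into {..<n} e q)" for q
    have c: "c (e v) = x' v" if "v < n" for v
      using that e by (simp add: c_def bij_betw_def)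
    have Yev: "eval_mpoly x' (Y p) = (\<Sum>q\<in>Q. a p q * c q)" for p
    proof -
      have "(\<Sum>q\<in>Q. a p q * c q) = (\<Sum>v<n. a p (e v) * c (e v))"
        by (rule sum.reindex_bij_betw [OF e, symmetric])
      then show ?thesis by (simp add: Y_def c)
    qed
    have xev: "eval_mpoly x' (monom_poly (x i)) = (\<Prod>q\<in>T (\<alpha> i). c q)" if "i \<le> m" for i
    proof -
      have "(\<Prod>q\<in>T (\<alpha> i). c q) = (\<Prod>v\<in>V i. c (e v))"
        by (rule prod.reindex_bij_betw [OF eV[OF that], symmetric])
      also have "\<dots> = (\<Prod>v\<in>V i. x' v)"
        by (rule prod.cong) (auto simp: V_def c)
      finally show ?thesis by (simp add: monom_poly_def x_def eval_set_monom)
    qed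
    have "eval_mpoly x' ((\<Sum>i=0..m. f i * monom_poly (x i)) - (\<Sum>i=1..m. l i))
      = (\<Sum>i=0..m. (\<Prod>p\<in>S (\<alpha> i). \<Sum>q\<in>Q. a p q * c q) * (\<Prod>q\<in>T (\<alpha> i). c q))
        + (\<Sum>i=1..m. \<Prod>p\<in>G (\<beta> i). \<Sum>q\<in>Q. a p q * c q)"
      by (simp add: f_def l_def Yev xev sum_negf)
    also have "\<dots> = 0"
      using zero[of c] sum.reindex_bij_betw[OF \<alpha>, of "\<lambda>i. (\<Prod>p\<in>S i. \<Sum>q\<in>Q. a p q * c q) * (\<Prod>q\<in>T i. c q)"]
        sum.reindex_bij_betw[OF \<beta>, of "\<lambda>i. \<Prod>p\<in>G i. \<Sum>q\<in>Q. a p q * c q"]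
      by (simp add: add.commute)
    finally show "eval_mpoly x' ((\<Sum>i=0..m. f i * monom_poly (x i)) - (\<Sum>i=1..m. l i)) = 0" .
  qed
  then have eq: "(\<Sum>i=1..m. l i) = (\<Sum>i=0..m. f i * monom_poly (x i))"
    by simp
  have "\<exists>i\<le>m. f i = 0"
  proof (rule C[unfolded property_C_def, rule_format, of x n l f])
    fix i assume "i \<le> m"
    then show "Poly_Mapping.keys (x i) \<subseteq> {..<n} \<and> squarefree_monom (x i)"
      by (auto simp: x_def keys_set_monom V_def squarefree_monom_def lookup_set_monom)
    have "card (S (\<alpha> i)) + card (T (\<alpha> i)) = d" using S \<alpha>A[OF \<open>i \<le> m\<close>] by blast
    then have "deg_monom (x i) \<le> d" "d - deg_monom (x i) = card (S (\<alpha> i))"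
      using cardV[OF \<open>i \<le> m\<close>] by (auto simp: x_def deg_set_monom)
    moreover have "lin_prod n (card (S (\<alpha> i))) (f i)"
      unfolding f_def using S \<alpha>A[OF \<open>i \<le> m\<close>] Ylin by (intro lin_prod_prod) auto
    ultimately show "if deg_monom (x i) \<le> d then lin_prod n (d - deg_monom (x i)) (f i) else f i = 0"
      by simp
  next
    fix i j assume ij: "i \<le> m" "j \<le> m" "i \<noteq> j"
    have "T (\<alpha> i) \<inter> T (\<alpha> j) = {}" by (intro disj \<alpha>A \<alpha>_neq ij)
    then show "coprime_monom (x i) (x j)"
      by (auto simp: coprime_monom_def x_def keys_set_monom V_def)
    have "card (T (\<alpha> i)) + card (T (\<alpha> j)) \<ge> d + 2" by (intro deg \<alpha>A \<alpha>_neq ij)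
    then show "d + 2 \<le> deg_monom (x i) + deg_monom (x j)"
      using ij by (simp add: x_def deg_set_monom cardV)
  next
    fix i assume "i \<in> {1..m}"
    then have "finite (G (\<beta> i))" "card (G (\<beta> i)) = d" using G \<beta>L by blast+
    then have "lin_prod n d (\<Prod>p\<in>G (\<beta> i). Y p)"
      using lin_prod_prod[of "G (\<beta> i)" n Y] Ylin by simp
    then show "lin_prod n d (l i)"
      unfolding l_def using d by (rule lin_prod_uminus)
  next
    show "(\<Sum>i=1..m. l i) = (\<Sum>i=0..m. f i * monom_poly (x i))" by (rule eq)
  qed
  then obtain i where i: "i \<le> m" "f i = 0" by blast
  have "finite (S (\<alpha> i))" using S \<alpha>A[OF i(1)] by blast
  with i(2) obtain p where p: "p \<in> S (\<alpha> i)" "Y p = 0"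
    by (auto simp: f_def prod_zero_iff)
  have "a p q = 0" if "q \<in> Q" for q
  proof -
    from that e have "q \<in> e ` {..<n}"
      by (simp add: bij_betw_def)
    then obtain u where u: "u < n" "q = e u" by blast
    \<comment> \<open>At a unit vector a form takes the value of the corresponding
      coefficient.\<close>
    have "eval_mpoly (\<lambda>v. if v = u then 1 else 0) (Y p) = (\<Sum>v<n. if v = u then a p (e v) else 0)"
      unfolding Y_def eval_form_poly by (intro sum.cong) auto
    also have "\<dots> = a p (e u)"
      using u by simp
    finally have "eval_mpoly (\<lambda>v. if v = u then 1 else 0) (Y p) = a p (e u)" .
    with p u show ?thesis by simp
  qed
  with p \<alpha>A[OF i(1)] show ?thesis by blast
qed

section \<open>Coordinate bases and the greedy choice\<close>

text \<open>For finite \<open>B\<close> this is linear independence of the coordinate functionals on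
  \<open>W\<close>, phrased as surjectivity of the restriction from \<open>W\<close> to K^B.\<close>

definition coord_indep :: "('i \<Rightarrow> 'k::field) set \<Rightarrow> 'i set \<Rightarrow> bool"
  where "coord_indep W B \<longleftrightarrow> (\<forall>c. \<exists>w\<in>W. \<forall>q\<in>B. w q = c q)"

lemma coord_indep_mono: "coord_indep W B \<Longrightarrow> A \<subseteq> B \<Longrightarrow> coord_indep W A"
  unfolding coord_indep_def by (meson subsetD)

lemma coord_subspaceD:
  assumes "coord.subspace W" "w \<in> W" "w' \<in> W"
  shows "(\<lambda>p. w p + a * w' p) \<in> W"
proof -
  have "w + scale_fun a w' \<in> W"
    using assms by (intro coord.subspace_add coord.subspace_scale)
  then show ?thesis
    by (simp add: scale_fun_def plus_fun_def)
qed

lemma coord_subspace_lin_comb: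
  assumes "coord.subspace W" "\<And>q. q \<in> Q \<Longrightarrow> u q \<in> W"
  shows "(\<lambda>p. \<Sum>q\<in>Q. u q p * c q) \<in> W"
proof -
  have "(\<lambda>_. 0) \<in> W"
    using coord.subspace_0[OF assms(1)] by (simp add: zero_fun_def)
  then show ?thesis
    using assms(2)
  proof (induction Q rule: infinite_finite_induct)
    case (insert q Q)
    then have "(\<lambda>p. (\<Sum>q\<in>Q. u q p * c q) + c q * u q p) \<in> W"
      by (intro coord_subspaceD[OF assms(1)]) auto
    with insert.hyps show ?case
      by (simp add: algebra_simps)
  qed auto
qed

text \<open>Multiples of \<open>w\<close> adjust the value at \<open>p\<close> without disturbing
  the values on \<open>B\<close>.\<close>

lemma coord_indep_insert:
  assumes W: "coord.subspace W" and B: "coord_indep W B"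
    and w: "w \<in> W" "\<And>q. q \<in> B \<Longrightarrow> w q = 0" "w p \<noteq> 0"
  shows "coord_indep W (insert p B)"
  unfolding coord_indep_def
proof
  fix c
  obtain v where v: "v \<in> W" "\<forall>q\<in>B. v q = c q"
    using B by (auto simp: coord_indep_def)
  let ?v = "\<lambda>q. v q + ((c p - v p) / w p) * w q"
  have "?v \<in> W" by (rule coord_subspaceD[OF W v(1) w(1)])
  moreover have "?v q = c q" if "q \<in> insert p B" for q
    by (cases "q = p") (use that v(2) w(2,3) in simp_all)
  ultimately show "\<exists>w\<in>W. \<forall>q\<in>insert p B. w q = c q"
    by (intro bexI[of _ ?v] ballI)
qed

lemma coord_indep_dual_basis:
  assumes "coord_indep W B"
  shows "\<exists>u. \<forall>q\<in>B. u q \<in> W \<and> (\<forall>q'\<in>B. u q q' = (if q' = q then 1 else 0))"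
proof -
  have "\<forall>q. \<exists>w. w \<in> W \<and> (\<forall>q'\<in>B. w q' = (if q' = q then 1 else 0))"
  proof
    fix q
    show "\<exists>w. w \<in> W \<and> (\<forall>q'\<in>B. w q' = (if q' = q then 1 else 0))"
      using assms[unfolded coord_indep_def, rule_format, of "\<lambda>q'. if q' = q then 1 else 0"] by blast
  qed
  from choice[OF this] show ?thesis by blast
qed

text \<open>By \<open>det\<close> every vector is the combination of the dual vectors whose
  coefficients are its own coordinates on \<open>B\<close>, so the dual vectors span
  \<open>W\<close>.\<close>

lemma dim_le_card_determining:
  assumes W: "coord.subspace W" and B: "finite B" "coord_indep W B"
    and det: "\<And>w. w \<in> W \<Longrightarrow> \<forall>q\<in>B. w q = 0 \<Longrightarrow> w = 0"
  shows "coord.dim W \<le> card B"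
proof -
  obtain u where u: "\<And>q. q \<in> B \<Longrightarrow> u q \<in> W"
      "\<And>q q'. q \<in> B \<Longrightarrow> q' \<in> B \<Longrightarrow> u q q' = (if q' = q then 1 else 0)"
    using coord_indep_dual_basis[OF B(2)] by blast
  have "w \<in> coord.span (u ` B)" if w: "w \<in> W" for w
  proof -
    let ?v = "\<lambda>p. \<Sum>q\<in>B. u q p * w q"
    have v: "?v \<in> coord.span (u ` B)"
      by (rule coord_subspace_lin_comb) (auto intro: coord.span_base)
    have "?v \<in> W" by (rule coord_subspace_lin_comb[OF W u(1)])
    have "?v q' = w q'" if "q' \<in> B" for q'
    proof -
      have "?v q' = (\<Sum>q\<in>B. if q = q' then w q else 0)"
        by (intro sum.cong) (use u(2) that in auto)
      with that B(1) show ?thesis by simp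
    qed
    with coord_subspaceD[OF W w \<open>?v \<in> W\<close>, of "- 1"] have "(\<lambda>p. w p + - 1 * ?v p) = 0"
      by (intro det) simp_all
    then have "w p = ?v p" for p
      by (drule_tac fun_cong[of _ _ p]) simp
    then have "w = ?v" ..
    with v show ?thesis by simp
  qed
  then have "coord.dim W \<le> card (u ` B)"
    using B(1) by (intro coord.dim_le_card) auto
  also have "\<dots> \<le> card B"
    by (rule card_image_le[OF B(1)])
  finally show ?thesis .
qed

text \<open>A space over an infinite field is no finite union of proper subspaces. In the induction,
  each coordinate vanishes for at most one \<open>a\<close> on the line
  \<open>w + a w'\<close>.\<close>

lemma ex_common_nonzero:
  fixes W :: "('i \<Rightarrow> 'k::field) set"
  assumes inf: "infinite (UNIV :: 'k set)" and W: "coord.subspace W"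
    and "finite P" "\<And>p. p \<in> P \<Longrightarrow> \<exists>w\<in>W. w p \<noteq> 0"
  shows "\<exists>w\<in>W. \<forall>p\<in>P. w p \<noteq> 0"
  using assms(3,4)
proof (induction P)
  case empty
  then show ?case using coord.subspace_0[OF W] by auto
next
  case (insert p P)
  then obtain w w' where w: "w \<in> W" "\<forall>p\<in>P. w p \<noteq> 0" and w': "w' \<in> W" "w' p \<noteq> 0"
    by blast
  \<comment> \<open>Where \<open>w' q = 0\<close> the quotient is 0 by convention, which merely
    excludes one more value of \<open>a\<close>.\<close>
  have "finite ((\<lambda>q. - w q / w' q) ` insert p P)" using insert.hyps by simp
  then obtain a where a: "a \<notin> (\<lambda>q. - w q / w' q) ` insert p P"
    using ex_new_if_finite[OF inf] by blast
  have "w q + a * w' q \<noteq> 0" if q: "q \<in> insert p P" for q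
  proof (cases "w' q = 0")
    case True
    with q w w' show ?thesis by auto
  next
    case False
    moreover have "a \<noteq> - w q / w' q" using a q by blast
    ultimately show ?thesis
      by (simp add: field_simps eq_neg_iff_add_eq_0)
  qed
  then show ?case
    using coord_subspaceD[OF W w(1) w'(1)] by (intro bexI[of _ "\<lambda>q. w q + a * w' q"] ballI)
qed

lemma greedy_partial:
  fixes ind :: "'i set \<Rightarrow> bool" and part :: "'g \<Rightarrow> 'i set"
  assumes "ind {}" and R: "finite R" "\<forall>h\<in>R. finite (part h)"
  shows "n \<le> card R \<Longrightarrow> \<exists>g T. inj_on g {..<n} \<and> g ` {..<n} \<subseteq> R \<and> (\<forall>i<n. T i \<subseteq> part (g i)) \<and>
    ind (\<Union>i<n. T i) \<and>
    (\<forall>i<n. \<forall>h\<in>R - g ` {..<i}. \<forall>T'\<subseteq>part h. ind ((\<Union>k<i. T k) \<union> T') \<longrightarrow> card T' \<le> card (T i))"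
proof (induction n)
  case 0
  then show ?case using assms by auto
next
  case (Suc n)
  then obtain g T where inj: "inj_on g {..<n}" and gR: "g ` {..<n} \<subseteq> R"
    and T: "\<forall>i<n. T i \<subseteq> part (g i)" and ind: "ind (\<Union>i<n. T i)"
    and max: "\<forall>i<n. \<forall>h\<in>R - g ` {..<i}. \<forall>T'\<subseteq>part h. ind ((\<Union>k<i. T k) \<union> T') \<longrightarrow> card T' \<le> card (T i)"
    by auto
  define P where "P = (\<lambda>(h, T'). h \<in> R - g ` {..<n} \<and> T' \<subseteq> part h \<and> ind ((\<Union>k<n. T k) \<union> T'))"
  have "card (g ` {..<n}) < card R"
    using Suc.prems card_image[OF inj] by simp
  then have "\<not> R \<subseteq> g ` {..<n}"
    using card_mono[of "g ` {..<n}" R] by auto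
  then obtain h0 where "h0 \<in> R - g ` {..<n}" by blast
  then have P0: "P (h0, {})" using ind by (simp add: P_def)
  \<comment> \<open>The candidates have bounded size, and \<open>(h0, {})\<close> is one, so there
    is a largest.\<close>
  have "card (snd y) < Suc (card (\<Union>h\<in>R. part h))" if "P y" for y
    using that R by (auto simp: P_def less_Suc_eq_le intro!: card_mono split: prod.splits)
  then obtain h T0 where P: "P (h, T0)" and best: "\<And>y. P y \<Longrightarrow> card (snd y) \<le> card T0"
    using ex_has_greatest_nat[of P "(h0, {})" "card \<circ> snd", OF P0] by (metis comp_apply prod.collapse snd_conv)
  let ?g = "g(n := h)" and ?T = "T(n := T0)"
  have im: "?g ` {..<i} = g ` {..<i}" "(\<Union>k<i. ?T k) = (\<Union>k<i. T k)" if "i \<le> n" for i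
    using that by auto
  have "inj_on ?g {..<Suc n}"
    using inj P by (auto simp: inj_on_def P_def less_Suc_eq)
  moreover have "?g ` {..<Suc n} \<subseteq> R"
    using gR P by (auto simp: P_def less_Suc_eq)
  moreover have "\<forall>i<Suc n. ?T i \<subseteq> part (?g i)"
    using T P by (auto simp: P_def less_Suc_eq)
  moreover have "ind (\<Union>i<Suc n. ?T i)"
  proof -
    have "(\<Union>i<Suc n. ?T i) = (\<Union>k<n. T k) \<union> T0"
      using im(2)[of n] unfolding lessThan_Suc UN_insert by auto
    with P show ?thesis by (simp add: P_def)
  qed
  moreover have "\<forall>i<Suc n. \<forall>h'\<in>R - ?g ` {..<i}. \<forall>T'\<subseteq>part h'.
      ind ((\<Union>k<i. ?T k) \<union> T') \<longrightarrow> card T' \<le> card (?T i)"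
  proof (intro allI impI ballI)
    fix i h' T'
    assume i: "i < Suc n" and h': "h' \<in> R - ?g ` {..<i}" and T': "T' \<subseteq> part h'" "ind ((\<Union>k<i. ?T k) \<union> T')"
    show "card T' \<le> card (?T i)"
    proof (cases "i = n")
      case True
      with h' T' have "P (h', T')"
        using im[of n] by (simp add: P_def)
      with best True show ?thesis by fastforce
    next
      case False
      with i have "i < n" "i \<le> n" by auto
      with h' T' max im[of i] show ?thesis by auto
    qed
  qed
  ultimately show ?case by blast
qed

text \<open>Run to the end, the choice numbers all parts. The sizes decrease because
  \<open>T j\<close> was itself a candidate at every step \<open>i\<close> before \<open>j\<close>,
  by heredity of \<open>ind\<close>.\<close>

lemma greedy:
  fixes ind :: "'i set \<Rightarrow> bool" and part :: "'g \<Rightarrow> 'i set"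
  assumes "ind {}" and mono: "\<forall>A B. ind B \<longrightarrow> A \<subseteq> B \<longrightarrow> ind A"
    and R: "finite R" "\<forall>h\<in>R. finite (part h)" and n_def: "n = card R"
  shows "\<exists>g T. bij_betw g {..<n} R \<and> (\<forall>i<n. T i \<subseteq> part (g i)) \<and> ind (\<Union>i<n. T i) \<and>
    (\<forall>i j. i \<le> j \<longrightarrow> j < n \<longrightarrow> card (T j) \<le> card (T i)) \<and>
    (\<forall>i j T'. i \<le> j \<longrightarrow> j < n \<longrightarrow> T' \<subseteq> part (g j) \<longrightarrow> ind ((\<Union>k<i. T k) \<union> T') \<longrightarrow>
      card T' \<le> card (T i))"
proof -
  obtain g T where inj: "inj_on g {..<n}" and gR: "g ` {..<n} \<subseteq> R"
    and T: "\<forall>i<n. T i \<subseteq> part (g i)" and ind: "ind (\<Union>i<n. T i)"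
    and max: "\<forall>i<n. \<forall>h\<in>R - g ` {..<i}. \<forall>T'\<subseteq>part h. ind ((\<Union>k<i. T k) \<union> T') \<longrightarrow> card T' \<le> card (T i)"
    using greedy_partial[of ind R part n, OF assms(1) R eq_refl[OF n_def]] by (elim exE conjE)
  have "g ` {..<n} = R"
    using gR R(1) card_image[OF inj] by (intro card_subset_eq) (auto simp: n_def)
  with inj have bij: "bij_betw g {..<n} R"
    by (simp add: bij_betw_def)
  have notin: "g j \<in> R - g ` {..<i}" if "i \<le> j" "j < n" for i j
  proof -
    have "g j \<noteq> g x" if "x < i" for x
      using inj_onD[OF inj, of j x] that \<open>i \<le> j\<close> \<open>j < n\<close> by auto
    with that gR show ?thesis by blast
  qed
  have *: "card T' \<le> card (T i)"
    if "i \<le> j" "j < n" "T' \<subseteq> part (g j)" "ind ((\<Union>k<i. T k) \<union> T')" for i j T'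
    using max[rule_format, OF _ notin[OF that(1,2)] that(3,4)] that(1,2) by simp
  have "card (T j) \<le> card (T i)" if "i \<le> j" "j < n" for i j
  proof (rule *[OF that])
    show "T j \<subseteq> part (g j)" using T that by blast
    have "(\<Union>k<i. T k) \<union> T j \<subseteq> (\<Union>k<n. T k)" using that by force
    with mono ind show "ind ((\<Union>k<i. T k) \<union> T j)" by blast
  qed
  with bij T ind * show ?thesis
    by (intro exI[of _ g] exI[of _ T] conjI) simp_all
qed

section \<open>Rows in greedy order\<close>

text \<open>\<open>W\<close> is the cone of a plane in the hypersurface, and \<open>g\<close>
  numbers its rows in greedy order. The assumption \<open>nonzero\<close> expresses that the plane
  is not one-split: over an infinite field a product of coordinates vanishes on \<open>W\<close>
  only if one of them does.\<close>

locale greedy_basis =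
  fixes W :: "(nat \<times> nat \<Rightarrow> 'k::field) set" and r d :: nat
    and g :: "nat \<Rightarrow> nat" and T :: "nat \<Rightarrow> (nat \<times> nat) set"
  assumes inf: "infinite (UNIV :: 'k set)"
    and d_pos: "d > 0"
    and subspace: "coord.subspace W"
    and g: "bij_betw g {..<r} {1..r}"
    and T_sub: "i < r \<Longrightarrow> T i \<subseteq> {g i} \<times> {1..d}"
    and indep: "coord_indep W (\<Union>i<r. T i)"
    and T_antimono: "i \<le> j \<Longrightarrow> j < r \<Longrightarrow> card (T j) \<le> card (T i)"
    and T_max: "i \<le> j \<Longrightarrow> j < r \<Longrightarrow> T' \<subseteq> {g j} \<times> {1..d} \<Longrightarrow>
      coord_indep W ((\<Union>k<i. T k) \<union> T') \<Longrightarrow> card T' \<le> card (T i)"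
    and zero: "w \<in> W \<Longrightarrow> (\<Sum>i<r. \<Prod>p\<in>{g i} \<times> {1..d}. w p) = 0"
    and nonzero: "p \<in> {1..r} \<times> {1..d} \<Longrightarrow> \<exists>w\<in>W. w p \<noteq> 0"
begin

definition row :: "nat \<Rightarrow> (nat \<times> nat) set"
  where "row i = {g i} \<times> {1..d}"

definition basis :: "(nat \<times> nat) set"
  where "basis = (\<Union>i<r. T i)"

text \<open>For fixed \<open>q\<close> this is a vector of \<open>W\<close>; for fixed
  \<open>p\<close> and varying \<open>q\<close> it gives the coefficients of the coordinate
  \<open>p\<close> in terms of the basis coordinates.\<close>

definition dual :: "nat \<times> nat \<Rightarrow> nat \<times> nat \<Rightarrow> 'k"
  where "dual = (SOME u. \<forall>q\<in>basis. u q \<in> W \<and> (\<forall>q'\<in>basis. u q q' = (if q' = q then 1 else 0)))"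

text \<open>For \<open>Q\<close> inside \<open>basis\<close>, a vector of \<open>W\<close> with
  values \<open>c\<close> on \<open>Q\<close> and 0 on the other basis coordinates; omitting blocks
  from \<open>Q\<close> sets them to 0.\<close>

definition point :: "(nat \<times> nat) set \<Rightarrow> (nat \<times> nat \<Rightarrow> 'k) \<Rightarrow> nat \<times> nat \<Rightarrow> 'k"
  where "point Q c p = (\<Sum>q\<in>Q. dual q p * c q)"

lemma finite_row [simp]: "finite (row i)" and card_row [simp]: "card (row i) = d"
  by (simp_all add: row_def)

lemma row_nonempty: "row i \<noteq> {}"
  using d_pos by (auto simp: row_def)

lemma T_row: "i < r \<Longrightarrow> T i \<subseteq> row i"
  unfolding row_def by (rule T_sub)

lemma finite_T: "i < r \<Longrightarrow> finite (T i)"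
  using T_row finite_row by (rule finite_subset)

lemma card_T_le: "i < r \<Longrightarrow> card (T i) \<le> d"
  using card_mono[OF finite_row T_row] by simp

lemma row_disjoint: "i < r \<Longrightarrow> j < r \<Longrightarrow> i \<noteq> j \<Longrightarrow> row i \<inter> row j = {}"
  using bij_betw_imp_inj_on[OF g] by (auto simp: row_def inj_on_def)

lemma T_disjoint: "i < r \<Longrightarrow> j < r \<Longrightarrow> i \<noteq> j \<Longrightarrow> T i \<inter> T j = {}"
  using row_disjoint[of i j] T_row[of i] T_row[of j] by blast

lemma T_basis: "i < r \<Longrightarrow> T i \<subseteq> basis"
  by (auto simp: basis_def)

lemma finite_basis: "finite basis"
  by (auto simp: basis_def finite_T)

lemma card_basis: "card basis = (\<Sum>i<r. card (T i))"
  unfolding basis_def by (rule card_UN_disjoint) (auto simp: finite_T T_disjoint)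

lemma dual: "q \<in> basis \<Longrightarrow> dual q \<in> W"
    "q \<in> basis \<Longrightarrow> q' \<in> basis \<Longrightarrow> dual q q' = (if q' = q then 1 else 0)"
  using someI_ex[OF coord_indep_dual_basis[OF indep]]
  unfolding dual_def basis_def by blast+

lemma row_index: "i < r \<Longrightarrow> row i \<subseteq> {1..r} \<times> {1..d}"
  using bij_betwE[OF g] by (auto simp: row_def)

text \<open>A vector of \<open>W\<close> that vanishes on the blocks up to \<open>i\<close> but not
  at \<open>p\<close> would allow \<open>p\<close> to be added to \<open>T i\<close>, against greedy
  maximality.\<close>

lemma determined:
  assumes "i < r" "p \<in> row i" "w \<in> W" "\<And>k q. k \<le> i \<Longrightarrow> q \<in> T k \<Longrightarrow> w q = 0"
  shows "w p = 0"
proof (rule ccontr)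
  assume "w p \<noteq> 0"
  then have "p \<notin> T i" using assms(4)[of i p] by blast
  have "(\<Union>k<i. T k) \<union> T i \<subseteq> (\<Union>i<r. T i)"
    using \<open>i < r\<close> by force
  then have "coord_indep W ((\<Union>k<i. T k) \<union> T i)"
    by (rule coord_indep_mono[OF indep])
  then have "coord_indep W (insert p ((\<Union>k<i. T k) \<union> T i))"
  proof (rule coord_indep_insert[OF subspace _ assms(3) _ \<open>w p \<noteq> 0\<close>])
    fix q assume "q \<in> (\<Union>k<i. T k) \<union> T i"
    then obtain k where "k \<le> i" "q \<in> T k" by (auto intro: less_imp_le)
    then show "w q = 0" by (rule assms(4))
  qed
  then have "card (insert p (T i)) \<le> card (T i)"
    using assms(1,2) T_row[OF assms(1)]
    by (intro T_max) (auto simp: row_def)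
  with \<open>p \<notin> T i\<close> show False
    using finite_T[OF assms(1)] by simp
qed

lemma determined_eq:
  assumes "i < r" "p \<in> row i" "w \<in> W" "w' \<in> W" "\<And>k q. k \<le> i \<Longrightarrow> q \<in> T k \<Longrightarrow> w q = w' q"
  shows "w p = w' p"
proof -
  have "w p + - 1 * w' p = 0"
    using coord_subspaceD[OF subspace assms(3,4), of "- 1"] assms(5)
    by (intro determined[OF assms(1,2), of "\<lambda>p. w p + - 1 * w' p"]) auto
  then show ?thesis by simp
qed

text \<open>A block as large as the first one was a maximal choice already at the start, when no
  other block was present. Hence row \<open>i\<close> depends on \<open>T i\<close> alone.\<close>

lemma determined_eq_max:
  assumes "i < r" "p \<in> row i" "w \<in> W" "w' \<in> W" "\<And>q. q \<in> T i \<Longrightarrow> w q = w' q"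
    and "card (T i) = card (T 0)"
  shows "w p = w' p"
proof (rule ccontr)
  assume neq: "w p \<noteq> w' p"
  then have "p \<notin> T i" using assms(5) by blast
  have "coord_indep W (T i)"
    by (rule coord_indep_mono[OF indep]) (use \<open>i < r\<close> in auto)
  then have "coord_indep W (insert p (T i))"
    using neq assms(5)
    by (intro coord_indep_insert[OF subspace _ coord_subspaceD[OF subspace assms(3,4), of "- 1"]]) auto
  then have "card (insert p (T i)) \<le> card (T 0)"
    using assms(1,2) T_row[OF assms(1)]
    by (intro T_max[of 0 i]) (auto simp: row_def)
  with \<open>p \<notin> T i\<close> show False
    using finite_T[OF assms(1)] assms(6) by simp
qed

lemma point_in_W: "Q \<subseteq> basis \<Longrightarrow> point Q c \<in> W"
  unfolding point_def [abs_def] using dual(1)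
  by (intro coord_subspace_lin_comb[OF subspace]) auto

lemma point_val:
  assumes "Q \<subseteq> basis" "q \<in> basis"
  shows "point Q c q = (if q \<in> Q then c q else 0)"
proof -
  have "point Q c q = (\<Sum>q'\<in>Q. if q' = q then c q' else 0)"
    unfolding point_def using assms by (intro sum.cong) (auto simp: dual(2))
  then show ?thesis
    using finite_subset[OF assms(1) finite_basis] by simp
qed

lemma point_T_other:
  assumes "q \<in> T j" "j < r" "a < r" "j \<noteq> a"
  shows "point (T a) c q = 0"
proof -
  have "q \<in> basis" "q \<notin> T a"
    using assms T_basis[of j] T_disjoint[of j a] by blast+
  then show ?thesis using point_val[OF T_basis[OF assms(3)]] by simp
qed

lemma point_agree:
  assumes "i < r" "p \<in> row i" "w \<in> W" "Q \<subseteq> basis" "\<And>k. k \<le> i \<Longrightarrow> T k \<subseteq> Q"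
  shows "point Q w p = w p"
proof (rule determined_eq[OF assms(1,2) point_in_W[OF assms(4)] assms(3)])
  fix k q assume "k \<le> i" "q \<in> T k"
  then show "point Q w q = w q"
    using assms(4,5) by (subst point_val) auto
qed

lemma nonzero_row:
  assumes "i < r" shows "\<exists>w\<in>W. \<forall>p\<in>row i. w p \<noteq> 0"
  by (rule ex_common_nonzero[OF inf subspace]) (use nonzero row_index[OF assms] in auto)

lemma zero_row: "w \<in> W \<Longrightarrow> (\<Sum>i<r. \<Prod>p\<in>row i. w p) = 0"
  unfolding row_def by (rule zero)

lemma prod_row_split: "i < r \<Longrightarrow> (\<Prod>p\<in>row i. w p) = (\<Prod>p\<in>row i - T i. w p) * (\<Prod>p\<in>T i. w p)"
  by (rule prod.subset_diff[OF T_row]) simp_all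

lemma prod_row_zero: "i < r \<Longrightarrow> q \<in> T i \<Longrightarrow> w q = (0 :: 'k) \<Longrightarrow> (\<Prod>p\<in>row i. w p) = 0"
  by (subst prod_zero_iff[OF finite_row]) (use T_row in blast)

text \<open>Setting the basis coordinates of the rows \<open>Suc (r - t), \<dots>, t - 1\<close> to \<open>0\<close> kills these rows and
  leaves the shape of property C, with the \<open>r - t\<close> last rows as the products \<open>l i\<close>.\<close>

lemma property_C_contradiction:
  assumes C: "property_C TYPE('k) d (r - t)"
    and t: "t \<le> r" "Suc (r - t) \<le> t" "\<And>i. i < t \<Longrightarrow> T i \<noteq> {}"
    and deg: "\<And>i j. i < j \<Longrightarrow> j < Suc (r - t) \<Longrightarrow> card (T i) + card (T j) \<ge> d + 2"
  shows False
proof -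
  \<comment> \<open>Property C for \<open>m = r - t\<close> takes \<open>m + 1\<close> rows of the
    shape f x; these are the first \<open>s\<close>.\<close>
  define s where "s = Suc (r - t)"
  define Q where "Q = (\<Union>i<s. T i)"
  have s: "s \<le> t" "s \<le> r" using t by (auto simp: s_def)
  have Q: "Q \<subseteq> basis" unfolding Q_def basis_def using s(2) by (intro UN_mono) auto
  have "\<exists>i\<in>{..<s}. \<exists>p\<in>row i - T i. \<forall>q\<in>Q. dual q p = 0"
  proof (rule property_C_forms[OF C inf d_pos, where L = "{t..<r}" and G = row and T = T])
    show "finite Q" by (rule finite_subset[OF Q finite_basis])
    show "finite (row i - T i) \<and> T i \<subseteq> Q \<and> card (row i - T i) + card (T i) = d" if "i \<in> {..<s}" for i
    proof -
      have "i < r" using that s by auto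
      then show ?thesis
        using that card_T_le[of i] T_row[of i] finite_T[of i] by (auto simp: card_Diff_subset Q_def)
    qed
    show "T i \<inter> T j = {}" if "i \<in> {..<s}" "j \<in> {..<s}" "i \<noteq> j" for i j
      using that s by (intro T_disjoint) auto
    show "d + 2 \<le> card (T i) + card (T j)" if "i \<in> {..<s}" "j \<in> {..<s}" "i \<noteq> j" for i j
      using deg[of i j] deg[of j i] that by (cases i j rule: linorder_cases) (auto simp: s_def)
    show "(\<Sum>i\<in>{t..<r}. \<Prod>p\<in>row i. \<Sum>q\<in>Q. dual q p * c q)
        + (\<Sum>i\<in>{..<s}. (\<Prod>p\<in>row i - T i. \<Sum>q\<in>Q. dual q p * c q) * (\<Prod>q\<in>T i. c q)) = 0" for c
    proof -
      let ?w = "point Q c"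
      have "(\<Prod>p\<in>row i. ?w p) = (\<Prod>p\<in>row i - T i. ?w p) * (\<Prod>q\<in>T i. c q)" if "i < s" for i
      proof -
        have "i < r" using that s by simp
        moreover have "(\<Prod>q\<in>T i. ?w q) = (\<Prod>q\<in>T i. c q)"
        proof (rule prod.cong[OF refl])
          fix q assume "q \<in> T i"
          then have "q \<in> Q" using that unfolding Q_def by blast
          then show "?w q = c q" using Q by (subst point_val[OF Q]) auto
        qed
        ultimately show ?thesis by (simp add: prod_row_split)
      qed
      then have A: "(\<Sum>i\<in>{..<s}. \<Prod>p\<in>row i. ?w p)
          = (\<Sum>i\<in>{..<s}. (\<Prod>p\<in>row i - T i. ?w p) * (\<Prod>q\<in>T i. c q))"
        by (intro sum.cong) auto
      \<comment> \<open>Each of these rows contains a basis coordinate outside \<open>Q\<close>,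
        where \<open>?w\<close> vanishes.\<close>
      have B: "(\<Sum>i\<in>{s..<t}. \<Prod>p\<in>row i. ?w p) = 0"
      proof (rule sum.neutral, rule ballI)
        fix i assume i: "i \<in> {s..<t}"
        then have "i < r" using t by auto
        obtain q where q: "q \<in> T i" using t(3)[of i] i by auto
        have "q \<notin> Q"
        proof
          assume "q \<in> Q"
          then obtain k where "k < s" "q \<in> T k" by (auto simp: Q_def)
          with q i \<open>i < r\<close> T_disjoint[of k i] show False by auto
        qed
        then have "?w q = 0"
          using q T_basis[OF \<open>i < r\<close>] by (subst point_val[OF Q]) auto
        with \<open>i < r\<close> q show "(\<Prod>p\<in>row i. ?w p) = 0"
          by (rule prod_row_zero)
      qed
      have "{..<r} = ({..<s} \<union> {s..<t}) \<union> {t..<r}" using s t by auto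
      then have "(\<Sum>i<r. \<Prod>p\<in>row i. ?w p) = (\<Sum>i\<in>{..<s}. \<Prod>p\<in>row i. ?w p)
          + (\<Sum>i\<in>{s..<t}. \<Prod>p\<in>row i. ?w p) + (\<Sum>i\<in>{t..<r}. \<Prod>p\<in>row i. ?w p)"
        using s t by (simp only:) (subst sum.union_disjoint, auto)+
      with zero_row[OF point_in_W[OF Q]] A B show ?thesis
        unfolding point_def by (simp add: add.commute)
    qed
  qed (use t in \<open>auto simp: s_def\<close>)
  \<comment> \<open>The coordinate \<open>p\<close> vanishes on all points of \<open>Q\<close>. But
    \<open>Q\<close> contains all blocks on which row \<open>i\<close> depends, so \<open>p\<close>
    would vanish on \<open>W\<close>.\<close>
  then obtain i p where i: "i < s" "p \<in> row i" and p: "\<forall>q\<in>Q. dual q p = 0" by blast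
  have "i < r" using i s by simp
  then obtain w where w: "w \<in> W" "w p \<noteq> 0"
    using nonzero_row i by blast
  have "T k \<subseteq> Q" if "k \<le> i" for k
    unfolding Q_def using that i by (intro UN_upper) simp
  then have "point Q w p = w p"
    by (rule point_agree[OF \<open>i < r\<close> i(2) w(1) Q])
  moreover have "point Q w p = 0"
    using p by (simp add: point_def)
  ultimately show False using w by simp
qed

end

section \<open>A bound for the sum of the block sizes\<close>

lemma sum_antimono_bound:
  fixes b :: "nat \<Rightarrow> nat"
  assumes antimono: "\<And>i j. i \<le> j \<Longrightarrow> j < t \<Longrightarrow> b j \<le> b i" and le: "\<And>i. i < t \<Longrightarrow> b i \<le> d"
    and u: "u + 2 \<le> t" and pair: "b u + b (Suc u) \<le> d + 1"
  shows "(\<Sum>i<t. b i) \<le> u * d + (d + 1) + (t - (u + 2)) * ((d + 1) div 2)"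
proof -
  have "(\<Sum>i<t. b i) = (\<Sum>i<u. b i) + (b u + b (Suc u)) + (\<Sum>i=u+2..<t. b i)"
    using sum.atLeastLessThan_concat[of 0 "u + 2" t b] u by (simp add: lessThan_atLeast0)
  moreover have "(\<Sum>i<u. b i) \<le> u * d"
    using sum_bounded_above[of "{..<u}" b d] le u by simp
  \<comment> \<open>Such \<open>b i\<close> is at most \<open>b u\<close> and at most
    \<open>b (Suc u)\<close>, hence at most half of their sum.\<close>
  moreover have "b i \<le> (d + 1) div 2" if "i \<in> {u + 2..<t}" for i
    using antimono[of u i] antimono[of "Suc u" i] that pair by simp
  then have "(\<Sum>i=u+2..<t. b i) \<le> (t - (u + 2)) * ((d + 1) div 2)"
    using sum_bounded_above[of "{u+2..<t}" b "(d + 1) div 2"] by simp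
  ultimately show ?thesis using pair by linarith
qed

lemma sum_lessThan_split:
  fixes f :: "nat \<Rightarrow> 'a::comm_monoid_add"
  assumes "m < r"
  shows "(\<Sum>j<r. f j) = (\<Sum>j\<in>{..m}. f j) + (\<Sum>j\<in>{m<..<r}. f j)"
proof -
  have "{..m} \<inter> {m<..<r} = {}" by auto
  from sum.union_disjoint[OF _ _ this, of f] show ?thesis
    by (simp add: ivl_disj_un_one(1)[OF assms])
qed

section \<open>Exceptional and extremal configurations of blocks\<close>

context greedy_basis
begin

lemma nonempty_rows:
  obtains t where "t \<le> r" "\<And>i. i < t \<Longrightarrow> T i \<noteq> {}" "\<And>i. t \<le> i \<Longrightarrow> i < r \<Longrightarrow> T i = {}"
proof
  let ?t = "LEAST i. i = r \<or> T i = {}"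
  show le: "?t \<le> r" by (rule Least_le) simp
  show "T i \<noteq> {}" if "i < ?t" for i using not_less_Least[OF that] by simp
  have t: "?t = r \<or> T ?t = {}" by (rule LeastI[of _ r]) simp
  show "T i = {}" if "?t \<le> i" "i < r" for i
  proof -
    have "T ?t = {}" using t that by auto
    then have "card (T i) = 0" using T_antimono[OF that] by simp
    then show ?thesis using finite_T[OF that(2)] by simp
  qed
qed

text \<open>The first four rows each depend on their own block alone. With only the blocks 0 and 1
  nonzero, rows 2 and 3 vanish. Where a factor \<open>p\<close> of row 4 vanishes too, the products
  of rows 0 and 1 must cancel, although they involve disjoint variables; a vector at which only one
  of them is nonzero refutes this.\<close>

lemma five_rows_contradiction:
  assumes r: "r = 5" and eq: "\<And>i. i < 4 \<Longrightarrow> card (T i) = card (T 0)" and two: "card (T 0) \<ge> 2"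
  shows False
proof -
  define supp where "supp k = {w \<in> W. \<forall>i<r. i \<noteq> k \<longrightarrow> (\<forall>q\<in>T i. w q = 0)}" for k
  have suppD: "x q = 0" if "x \<in> supp k" "q \<in> T i" "i < 5" "i \<noteq> k" for x k i q
    using that unfolding supp_def r by blast
  obtain p where p: "p \<in> row 4" using row_nonempty by blast
  have ne: "T i \<noteq> {}" if "i < 4" for i using eq[OF that] two by auto
  have star: "(\<Prod>q\<in>row 0. x q) + (\<Prod>q\<in>row 1. y q) = 0"
    if x: "x \<in> supp 0" and y: "y \<in> supp 1" and xy: "x p + y p = 0" for x y
  proof -
    define w where "w = (\<lambda>q. x q + 1 * y q)"
    have xW: "x \<in> W" and yW: "y \<in> W" using x y by (auto simp: supp_def)
    have wW: "w \<in> W" unfolding w_def by (rule coord_subspaceD[OF subspace xW yW])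
    have w0: "w q = x q" if "q \<in> row 0" for q
    proof (rule determined_eq_max[OF _ that wW xW])
      show "w q = x q" if "q \<in> T 0" for q using suppD[OF y that] by (simp add: w_def)
    qed (use r in simp_all)
    have w1: "w q = y q" if "q \<in> row 1" for q
    proof (rule determined_eq_max[OF _ that wW yW])
      show "w q = y q" if "q \<in> T 1" for q using suppD[OF x that] by (simp add: w_def)
    qed (use r eq[of 1] in simp_all)
    have wz: "(\<Prod>q\<in>row i. w q) = 0" if i: "i = 2 \<or> i = 3" for i
    proof -
      obtain q where q: "q \<in> T i" using ne[of i] i by auto
      then have "w q = 0"
        using suppD[OF x q] suppD[OF y q] i by (auto simp: w_def)
      then show ?thesis
        using prod_row_zero[OF _ q] i r by auto
    qed
    have w4: "(\<Prod>q\<in>row 4. w q) = 0"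
      by (subst prod_zero_iff[OF finite_row]) (use p xy in \<open>auto simp: w_def\<close>)
    have "(\<Sum>i<5. \<Prod>q\<in>row i. w q) = 0" using zero_row[OF wW] r by simp
    moreover have "{..<5} = {0, 1, 2, 3, 4 :: nat}" by auto
    ultimately show ?thesis
      using wz[of 2] wz[of 3] w4 w0 w1 by simp
  qed
  have full: "\<exists>x\<in>supp k. (\<Prod>q\<in>row k. x q) \<noteq> 0" if "k < 4" for k
  proof -
    have k: "k < r" using that r by simp
    obtain w where w: "w \<in> W" "\<forall>p\<in>row k. w p \<noteq> 0" using nonzero_row[OF k] by blast
    let ?x = "point (T k) w"
    have xW: "?x \<in> W" by (rule point_in_W[OF T_basis[OF k]])
    have val: "?x q = (if q \<in> T k then w q else 0)" if "q \<in> basis" for q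
      by (rule point_val[OF T_basis[OF k] that])
    have "?x q = w q" if "q \<in> row k" for q
    proof (rule determined_eq_max[OF k that xW w(1)])
      show "?x q = w q" if "q \<in> T k" for q using val[of q] that T_basis[OF k] by auto
    qed (rule eq[OF \<open>k < 4\<close>])
    then have "(\<Prod>q\<in>row k. ?x q) \<noteq> 0" using w(2) by (subst prod_zero_iff) auto
    moreover have "?x q = 0" if "i < r" "i \<noteq> k" "q \<in> T i" for i q
      using that(3,1) k that(2) by (rule point_T_other)
    then have "?x \<in> supp k" using xW by (auto simp: supp_def)
    ultimately show ?thesis by blast
  qed
  have z: "(\<lambda>_. 0) \<in> supp k" for k
    using coord.subspace_0[OF subspace] by (simp add: supp_def zero_fun_def)
  obtain x y where x: "x \<in> supp 0" "(\<Prod>q\<in>row 0. x q) \<noteq> 0" and y: "y \<in> supp 1" "(\<Prod>q\<in>row 1. y q) \<noteq> 0"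
    using full[of 0] full[of 1] by auto
  \<comment> \<open>Paired with the zero vector, \<open>star\<close> shows that \<open>p\<close>
    cannot vanish where the row product does not.\<close>
  have xp: "x p \<noteq> 0" using star[OF x(1) z] x(2) d_pos by (auto simp: power_0_left simp del: prod_zero_iff)
  have yp: "y p \<noteq> 0" using star[OF z y(1)] y(2) d_pos by (auto simp: power_0_left simp del: prod_zero_iff)
  have T0: "T 0 \<subseteq> basis" "T 0 \<subseteq> row 0" using T_basis[of 0] T_row[of 0] r by auto
  obtain q0 where q0: "q0 \<in> T 0" "dual q0 p \<noteq> 0"
  proof -
    have "x p = point (T 0) x p"
    proof (rule determined_eq[of 4 p])
      show "x q = point (T 0) x q" if "k \<le> 4" "q \<in> T k" for k q
      proof -
        have k: "k < r" using that r by simp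
        then have "q \<in> basis" using that T_basis by blast
        then have "point (T 0) x q = (if q \<in> T 0 then x q else 0)" by (rule point_val[OF T0(1)])
        moreover have "x q = 0" if "q \<notin> T 0"
        proof -
          have "k \<noteq> 0" using that \<open>q \<in> T k\<close> by metis
          then show ?thesis using x(1) k \<open>q \<in> T k\<close> unfolding supp_def by blast
        qed
        ultimately show ?thesis by simp
      qed
    qed (use p x r point_in_W T0 in \<open>auto simp: supp_def\<close>)
    with xp have "(\<Sum>q\<in>T 0. dual q p * x q) \<noteq> 0" by (simp add: point_def)
    then obtain q where "q \<in> T 0" "dual q p * x q \<noteq> 0" by (rule sum.not_neutral_contains_not_neutral)
    with that show ?thesis by auto
  qed
  \<comment> \<open>A second coordinate of the block, at which \<open>dual q0\<close> vanishes: its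
    product over row 0 is 0.\<close>
  obtain q1 where q1: "q1 \<in> T 0" "q1 \<noteq> q0"
    using two card_le_Suc0_iff_eq[OF finite_T[of 0]] q0(1) r
    by (metis One_nat_def not_less_eq_eq numeral_2_eq_2 zero_less_numeral)
  have "dual q0 \<in> supp 0"
  proof -
    have q0b: "q0 \<in> basis" using q0(1) T0(1) by blast
    have "dual q0 q = 0" if i: "i < r" "i \<noteq> 0" "q \<in> T i" for i q
    proof -
      have "q \<in> basis" using T_basis[OF i(1)] i(3) by blast
      moreover have "q \<noteq> q0" using T_disjoint[of i 0] i q0(1) by auto
      ultimately show ?thesis by (simp add: dual(2)[OF q0b])
    qed
    then show ?thesis using dual(1)[OF q0b] by (simp add: supp_def)
  qed
  \<comment> \<open>This multiple of \<open>y\<close> cancels \<open>dual q0\<close> at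
    \<open>p\<close>, while its product over row 1 stays nonzero.\<close>
  define a where "a = - dual q0 p / y p"
  have "(\<lambda>q. a * y q) \<in> supp 1"
    using coord_subspaceD[OF subspace, of "\<lambda>_. 0" y a] z[of 1] y(1) by (auto simp: supp_def)
  moreover have "dual q0 p + a * y p = 0" using yp by (simp add: a_def)
  ultimately have "(\<Prod>q\<in>row 0. dual q0 q) + (\<Prod>q\<in>row 1. a * y q) = 0"
    by (rule star[OF \<open>dual q0 \<in> supp 0\<close>])
  moreover have "(\<Prod>q\<in>row 0. dual q0 q) = 0"
  proof (rule prod_row_zero[OF _ q1(1)])
    show "dual q0 q1 = 0" using q0(1) q1 T0(1) by (subst dual(2)) auto
  qed (simp add: r)
  moreover have "a \<noteq> 0" using q0 yp by (simp add: a_def)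
  ultimately show False using y(2) by (simp add: prod.distrib)
qed

text \<open>On the hyperplane where \<open>p\<close> vanishes, row \<open>i\<close> disappears and
  \<open>m\<close> of the last rows remain. A basis coordinate \<open>q0\<close> occurring in
  \<open>p\<close> can be eliminated there; its row becomes one linear form times
  \<open>d - 1\<close> variables. Property C makes that form 0, so \<open>q0\<close> vanishes
  together with \<open>p\<close>.\<close>

lemma full_rows_proportional:
  assumes C: "property_C TYPE('k) d m" and r: "r = 2 * Suc m" and d: "d \<ge> 3"
    and full: "\<And>i. i \<le> m \<Longrightarrow> T i = row i" and empty: "\<And>i. m < i \<Longrightarrow> i < r \<Longrightarrow> T i = {}"
    and i: "m < i" "i < r" and p: "p \<in> row i"
  shows "\<exists>q0\<in>basis. \<exists>b. \<forall>w\<in>W. w p = b * w q0"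
proof -
  have m: "Suc m \<le> r" using r by simp
  have pb: "w p = (\<Sum>q\<in>basis. dual q p * w q)" if "w \<in> W" for w
    using point_agree[OF i(2) p that subset_refl] T_basis i by (simp add: point_def)
  obtain w0 where "w0 \<in> W" "w0 p \<noteq> 0" using nonzero_row[OF i(2)] p by blast
  then have "(\<Sum>q\<in>basis. dual q p * w0 q) \<noteq> 0" using pb by simp
  then obtain q0 where q0: "q0 \<in> basis" "dual q0 p * w0 q0 \<noteq> 0"
    by (rule sum.not_neutral_contains_not_neutral)
  then have q0p: "dual q0 p \<noteq> 0" by auto
  obtain a0 where a0: "a0 < r" "q0 \<in> T a0" using q0(1) by (auto simp: basis_def)
  then have a0m: "a0 \<le> m" using empty[of a0] by (cases "a0 \<le> m") auto
  \<comment> \<open>The coefficient of \<open>q\<close> in the coordinate \<open>p'\<close> after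
    \<open>q0\<close> is eliminated by the equation \<open>p = 0\<close>.\<close>
  define a where "a p' q = dual q p' - dual q0 p' * (dual q p / dual q0 p)" for p' q
  define Q where "Q = basis - {q0}"
  define S where "S j = (if j = a0 then {q0} else {})" for j
  have q0T: "q0 \<notin> T j" if "j \<le> m" "j \<noteq> a0" for j
    using T_disjoint[of j a0] that a0 a0m r by auto
  have cardT: "card (T j - {q0}) = (if j = a0 then d - 1 else d)" if "j \<le> m" for j
    using q0T[OF that] full[OF that] a0 full[OF a0m] by auto
  have "\<exists>j\<in>{..m}. \<exists>p'\<in>S j. \<forall>q\<in>Q. a p' q = 0"
  proof (rule property_C_forms[OF C inf d_pos, where L = "{m<..<r} - {i}" and G = row and T = "\<lambda>j. T j - {q0}"])
    show "finite Q" using finite_basis by (simp add: Q_def)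
    show "card ({m<..<r} - {i}) = m" using i r by (simp add: card_Diff_subset)
    show "finite (S j) \<and> T j - {q0} \<subseteq> Q \<and> card (S j) + card (T j - {q0}) = d" if "j \<in> {..m}" for j
      using cardT[of j] that T_basis[of j] r d_pos by (auto simp: S_def Q_def)
    show "(T j - {q0}) \<inter> (T k - {q0}) = {}" if "j \<in> {..m}" "k \<in> {..m}" "j \<noteq> k" for j k
      using T_disjoint[of j k] that r by auto
    \<comment> \<open>At most one of the two sizes drops to \<open>d - 1\<close>, so
      \<open>d >= 3\<close> suffices.\<close>
    show "d + 2 \<le> card (T j - {q0}) + card (T k - {q0})" if "j \<in> {..m}" "k \<in> {..m}" "j \<noteq> k" for j k
      using cardT[of j] cardT[of k] that d by (auto split: if_splits)
    show "(\<Sum>j\<in>{m<..<r} - {i}. \<Prod>p'\<in>row j. \<Sum>q\<in>Q. a p' q * c q)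
      + (\<Sum>j\<in>{..m}. (\<Prod>p'\<in>S j. \<Sum>q\<in>Q. a p' q * c q) * (\<Prod>q\<in>T j - {q0}. c q)) = 0" for c
    proof -
      \<comment> \<open>The value at \<open>q0\<close> is the one that makes the coordinate
        \<open>p\<close> vanish.\<close>
      define c' where "c' = c(q0 := - (\<Sum>q\<in>Q. dual q p * c q) / dual q0 p)"
      let ?w = "point basis c'"
      have wW: "?w \<in> W" by (rule point_in_W) simp
      have w: "?w p' = (\<Sum>q\<in>Q. a p' q * c q)" for p'
      proof -
        have "?w p' = dual q0 p' * c' q0 + (\<Sum>q\<in>Q. dual q p' * c' q)"
          unfolding point_def Q_def using q0(1) finite_basis by (subst sum.remove[of _ q0]) auto
        also have "(\<Sum>q\<in>Q. dual q p' * c' q) = (\<Sum>q\<in>Q. dual q p' * c q)"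
          by (intro sum.cong) (auto simp: c'_def Q_def)
        also have "dual q0 p' * c' q0 + (\<Sum>q\<in>Q. dual q p' * c q) = (\<Sum>q\<in>Q. a p' q * c q)"
          by (simp add: c'_def a_def algebra_simps sum_subtractf sum_divide_distrib sum_distrib_left)
        finally show ?thesis .
      qed
      have "?w p = 0"
        unfolding w using q0p by (simp add: a_def)
      then have wi: "(\<Prod>p'\<in>row i. ?w p') = 0"
        using p by (subst prod_zero_iff) auto
      have wT: "?w q = c' q" if "q \<in> basis" for q
        using that by (simp add: point_val)
      have wj: "(\<Prod>p'\<in>row j. ?w p') = (\<Prod>p'\<in>S j. ?w p') * (\<Prod>q\<in>T j - {q0}. c q)" if "j \<le> m" for j
      proof -
        have jr: "j < r" using that r by simp
        have "row j = S j \<union> (T j - {q0})" "S j \<inter> (T j - {q0}) = {}"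
          using full[OF that] q0T[OF that] a0(2) full[OF a0m] by (auto simp: S_def)
        then have "(\<Prod>p'\<in>row j. ?w p') = (\<Prod>p'\<in>S j. ?w p') * (\<Prod>q\<in>T j - {q0}. ?w q)"
          using finite_T[OF jr] by (simp add: prod.union_disjoint S_def)
        moreover have "(\<Prod>q\<in>T j - {q0}. ?w q) = (\<Prod>q\<in>T j - {q0}. c q)"
        proof (rule prod.cong[OF refl])
          fix q assume q: "q \<in> T j - {q0}"
          then have "q \<in> basis" using T_basis[OF jr] by blast
          then have "?w q = c' q" by (rule wT)
          also have "c' q = c q" using q by (simp add: c'_def)
          finally show "?w q = c q" .
        qed
        ultimately show ?thesis by simp
      qed
      have "(\<Sum>j<r. \<Prod>p'\<in>row j. ?w p') = (\<Sum>j\<in>{..m}. \<Prod>p'\<in>row j. ?w p')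
          + (\<Sum>j\<in>{m<..<r}. \<Prod>p'\<in>row j. ?w p')"
        using m by (intro sum_lessThan_split) simp
      also have "(\<Sum>j\<in>{m<..<r}. \<Prod>p'\<in>row j. ?w p') = (\<Sum>j\<in>{m<..<r} - {i}. \<Prod>p'\<in>row j. ?w p')"
        using i wi by (subst sum.remove[of _ i]) auto
      also have "(\<Sum>j\<in>{..m}. \<Prod>p'\<in>row j. ?w p') = (\<Sum>j\<in>{..m}. (\<Prod>p'\<in>S j. ?w p') * (\<Prod>q\<in>T j - {q0}. c q))"
        by (rule sum.cong[OF refl]) (simp add: wj)
      finally show ?thesis using zero_row[OF wW] by (simp add: w add.commute)
    qed
  qed auto
  \<comment> \<open>Only \<open>S a0\<close> is nonempty, so the vanishing form is the one that
    replaces \<open>q0\<close>.\<close>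
  then have "\<forall>q\<in>Q. a q0 q = 0" by (auto simp: S_def split: if_splits)
  then have dq: "dual q p = 0" if "q \<in> Q" for q
  proof -
    have "q \<in> basis" "q \<noteq> q0" using that by (auto simp: Q_def)
    then have "dual q q0 = 0" "dual q0 q0 = 1" using q0(1) by (auto simp: dual(2))
    moreover have "a q0 q = 0" using \<open>\<forall>q\<in>Q. a q0 q = 0\<close> that by blast
    ultimately show ?thesis using q0p by (simp add: a_def)
  qed
  have "w p = dual q0 p * w q0" if "w \<in> W" for w
  proof -
    have "w p = dual q0 p * w q0 + (\<Sum>q\<in>Q. dual q p * w q)"
      unfolding pb[OF that] Q_def using q0(1) finite_basis by (subst sum.remove[of _ q0]) auto
    then show ?thesis using dq by simp
  qed
  with q0(1) show ?thesis by blast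
qed

end

text \<open>With \<open>t = u + 2 + v\<close> one has \<open>r = 2 u + v + 3\<close>. For even
  \<open>d\<close> the upper bound is \<open>2 D <= (r - 1) d + 2\<close>, below both lower bounds.
  For odd \<open>d\<close> rounding adds \<open>v\<close>: if \<open>r\<close> is even this forces
  \<open>d <= v + 2 < r\<close>, and for \<open>r = 3\<close> or \<open>r = 5\<close> only
  \<open>u = 0\<close>, \<open>v = 2\<close> survives, with equality.\<close>

lemma small_basis_arith:
  fixes r d t u D :: nat
  assumes D: "D \<le> u * d + (d + 1) + (t - (u + 2)) * ((d + 1) div 2)" and u: "u + 2 \<le> t" and r: "r = t + u + 1"
    and d: "d \<ge> 3" and cond: "even d \<or> (even r \<and> d \<ge> r) \<or> (odd r \<and> r \<le> 5)"
    and large: "(odd r \<and> D \<ge> ((r - 1) div 2) * d + 2) \<or> (even r \<and> D \<ge> (r div 2) * d)"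
  shows "r = 5 \<and> t = 4 \<and> u = 0 \<and> D = 2 * d + 2"
proof -
  obtain v where v: "t = u + 2 + v" using u le_Suc_ex by blast
  have rv: "r = 2 * u + v + 3" using r v by simp
  show ?thesis
  proof (cases "even d")
    case True
    then obtain e where e: "d = 2 * e" by blast
    then have e2: "e \<ge> 2" using d by simp
    have "2 * D \<le> (2 * u + v + 2) * d + 2"
      using D by (simp add: v e algebra_simps)
    moreover have "2 * D \<ge> (2 * u + v + 2) * d + 4 \<or> 2 * D \<ge> (2 * u + v + 3) * d"
    proof (cases "odd r")
      case True
      then have "2 * ((r - 1) div 2) = 2 * u + v + 2" using rv by presburger
      then have "2 * (((r - 1) div 2) * d) = (2 * u + v + 2) * d" by (metis mult.assoc)
      then show ?thesis using large True by auto
    next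
      case False
      then have "2 * (r div 2) = 2 * u + v + 3" using rv by presburger
      then have "2 * ((r div 2) * d) = (2 * u + v + 3) * d" by (metis mult.assoc)
      then show ?thesis using large False by auto
    qed
    ultimately have False using d by (auto simp: algebra_simps)
    then show ?thesis ..
  next
    case False
    then obtain e where e: "d = 2 * e + 1" by (elim oddE)
    have D': "2 * D \<le> (2 * u + v + 2) * d + 2 + v"
      using D by (simp add: v e algebra_simps)
    show ?thesis
    proof (cases "odd r")
      case True
      then have "r = 3 \<or> r = 5" using cond False rv by (auto elim!: oddE)
      then have "(u = 0 \<and> v = 0 \<and> r = 3) \<or> (u = 1 \<and> v = 0 \<and> r = 5) \<or> (u = 0 \<and> v = 2 \<and> r = 5)"
        using rv by presburger
      then show ?thesis using D' large True False v by auto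
    next
      case F: False
      then have "2 * (r div 2) = 2 * u + v + 3" using rv by presburger
      then have "2 * ((r div 2) * d) = (2 * u + v + 3) * d" by (metis mult.assoc)
      then have "(2 * u + v + 3) * d \<le> 2 * D" using large F by auto
      then have "d \<le> v + 2" using D' by (simp add: algebra_simps)
      moreover have "d \<ge> 2 * u + v + 3" using cond False F rv by auto
      ultimately show ?thesis by simp
    qed
  qed
qed

section \<open>Matching of rows and the size of a basis\<close>

context greedy_basis
begin

text \<open>At a point that is 1 on block \<open>a\<close> and 0 on the others, row \<open>a\<close>
  contributes 1, so one of the last rows is nonzero there, and all its coordinates are multiples of
  coordinates of block \<open>a\<close>. Counting makes this a bijection between the two halves of
  the rows. Restricted to block 0, only row 0 and its partner survive.\<close>

lemma two_rows_cancel: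
  assumes C: "property_C TYPE('k) d m" and r: "r = 2 * Suc m" and d: "d \<ge> 3"
    and full: "\<And>i. i \<le> m \<Longrightarrow> T i = row i" and empty: "\<And>i. m < i \<Longrightarrow> i < r \<Longrightarrow> T i = {}"
  shows "\<exists>b. 0 < b \<and> b < r \<and> (\<forall>w\<in>W. (\<Prod>p\<in>row 0. w p) + (\<Prod>p\<in>row b. w p) = 0)"
proof -
  have mr: "j < r" if "j \<le> m" for j using that r by simp
  have "\<exists>q0\<in>basis. \<exists>b. \<forall>w\<in>W. w p = b * w q0" if "m < i" "i < r" "p \<in> row i" for i p
    by (rule full_rows_proportional[OF C r d full empty that])
  then have "\<forall>p. \<exists>q0. p \<in> (\<Union>i\<in>{m<..<r}. row i) \<longrightarrow> q0 \<in> basis \<and> (\<exists>b. \<forall>w\<in>W. w p = b * w q0)"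
    by (metis UN_E greaterThanLessThan_iff)
  from choice[OF this] obtain \<pi> where \<pi>: "\<And>p. p \<in> (\<Union>i\<in>{m<..<r}. row i) \<longrightarrow>
      \<pi> p \<in> basis \<and> (\<exists>b. \<forall>w\<in>W. w p = b * w (\<pi> p))" by blast
  have \<pi>b: "\<pi> p \<in> basis" and scaled: "\<exists>b. \<forall>w\<in>W. w p = b * w (\<pi> p)"
    if "m < i" "i < r" "p \<in> row i" for i p
    using \<pi>[of p] that by auto
  have match: "\<exists>i. m < i \<and> i < r \<and> (\<forall>p\<in>row i. \<pi> p \<in> T a)" if a: "a \<le> m" for a
  proof -
    have Ta: "T a \<subseteq> basis" by (rule T_basis[OF mr[OF a]])
    let ?w = "point (T a) (\<lambda>_. 1)"
    have wW: "?w \<in> W" by (rule point_in_W[OF Ta])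
    have w: "?w q = (if q \<in> T a then 1 else 0)" if "q \<in> basis" for q
      by (rule point_val[OF Ta that])
    have wj: "(\<Prod>p\<in>row j. ?w p) = (if j = a then 1 else 0)" if "j \<le> m" for j
    proof (cases "j = a")
      case True
      then have "(\<Prod>p\<in>row j. ?w p) = 1"
        using w Ta full[OF a] by (intro prod.neutral) auto
      with True show ?thesis by simp
    next
      case False
      obtain q where q: "q \<in> T j" using row_nonempty[of j] full[OF \<open>j \<le> m\<close>] by auto
      then have "?w q = 0"
        using mr[OF that] mr[OF a] False by (rule point_T_other)
      then show ?thesis using prod_row_zero[OF mr[OF that] q] False by simp
    qed
    have "(\<Sum>j<r. \<Prod>p\<in>row j. ?w p) = (\<Sum>j\<in>{..m}. \<Prod>p\<in>row j. ?w p)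
        + (\<Sum>j\<in>{m<..<r}. \<Prod>p\<in>row j. ?w p)"
      using r by (intro sum_lessThan_split) simp
    also have "(\<Sum>j\<in>{..m}. \<Prod>p\<in>row j. ?w p) = (\<Sum>j\<in>{..m}. if j = a then 1 else 0)"
      by (rule sum.cong[OF refl]) (simp add: wj)
    also have "\<dots> = 1" using a by simp
    finally have "(\<Sum>j\<in>{m<..<r}. \<Prod>p\<in>row j. ?w p) \<noteq> 0"
      using zero_row[OF wW] by auto
    then obtain i where i: "i \<in> {m<..<r}" "(\<Prod>p\<in>row i. ?w p) \<noteq> 0"
      by (rule sum.not_neutral_contains_not_neutral)
    have "\<pi> p \<in> T a" if p: "p \<in> row i" for p
    proof -
      have "?w p \<noteq> 0" using i(2) p by (simp add: prod_zero_iff)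
      then have "?w (\<pi> p) \<noteq> 0" using scaled[of i p] i(1) p wW by auto
      then show ?thesis using w[OF \<pi>b[of i p]] i(1) p by (auto split: if_splits)
    qed
    with i(1) show ?thesis by auto
  qed
  then have "\<forall>a. \<exists>i. a \<le> m \<longrightarrow> m < i \<and> i < r \<and> (\<forall>p\<in>row i. \<pi> p \<in> T a)" by blast
  from choice[OF this] obtain \<tau> where \<tau>: "\<And>a. a \<le> m \<Longrightarrow> m < \<tau> a"
      "\<And>a. a \<le> m \<Longrightarrow> \<tau> a < r" "\<And>a p. a \<le> m \<Longrightarrow> p \<in> row (\<tau> a) \<Longrightarrow> \<pi> p \<in> T a" by blast
  have inj: "inj_on \<tau> {..m}"
  proof (rule inj_onI)
    fix a b assume ab: "a \<in> {..m}" "b \<in> {..m}" "\<tau> a = \<tau> b"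
    obtain p where "p \<in> row (\<tau> a)" using row_nonempty by blast
    then have "\<pi> p \<in> T a \<inter> T b" using \<tau>(3)[of a p] \<tau>(3)[of b p] ab by auto
    then show "a = b" using T_disjoint[OF mr mr, of a b] ab by auto
  qed
  \<comment> \<open>Both halves consist of \<open>m + 1\<close> rows.\<close>
  have surj: "\<tau> ` {..m} = {m<..<r}"
  proof (rule card_subset_eq)
    show "\<tau> ` {..m} \<subseteq> {m<..<r}" using \<tau> by auto
    show "card (\<tau> ` {..m}) = card {m<..<r}" using card_image[OF inj] r by simp
  qed simp
  have "(\<Prod>p\<in>row 0. w p) + (\<Prod>p\<in>row (\<tau> 0). w p) = 0" if wW: "w \<in> W" for w
  proof -
    have T0: "T 0 \<subseteq> basis" using T_basis[OF mr[of 0]] by simp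
    let ?v = "point (T 0) w"
    have vW: "?v \<in> W" by (rule point_in_W[OF T0])
    have v: "?v q = (if q \<in> T 0 then w q else 0)" if "q \<in> basis" for q
      by (rule point_val[OF T0 that])
    have "(\<Prod>p\<in>row j. ?v p) = 0" if j: "j < r" "j \<noteq> 0" "j \<noteq> \<tau> 0" for j
    proof (cases "j \<le> m")
      case True
      obtain q where q: "q \<in> T j" using row_nonempty[of j] full[OF True] by auto
      then have "?v q = 0"
        using j(1) mr[of 0] j(2) by (intro point_T_other) auto
      then show ?thesis by (rule prod_row_zero[OF j(1) q])
    next
      case False
      then have "j \<in> \<tau> ` {..m}" unfolding surj using j(1) by simp
      then obtain b where b: "b \<le> m" "j = \<tau> b" by auto
      then have "b \<noteq> 0" using j(3) by metis
      obtain p where p: "p \<in> row j" using row_nonempty by blast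
      have "\<pi> p \<in> T b" using \<tau>(3)[OF b(1)] p b(2) by simp
      then have "?v (\<pi> p) = 0"
        using mr[OF b(1)] mr[of 0] \<open>b \<noteq> 0\<close> by (intro point_T_other) auto
      then have "?v p = 0" using scaled[of j p] False j(1) p vW by auto
      then show ?thesis using p by (subst prod_zero_iff) auto
    qed
    then have "(\<Sum>j<r. \<Prod>p\<in>row j. ?v p) = (\<Sum>j\<in>{0, \<tau> 0}. \<Prod>p\<in>row j. ?v p)"
      using \<tau>(2)[of 0] r by (intro sum.mono_neutral_right) auto
    also have "\<dots> = (\<Prod>p\<in>row 0. ?v p) + (\<Prod>p\<in>row (\<tau> 0). ?v p)"
      using \<tau>(1)[of 0] by simp
    also have "(\<Prod>p\<in>row 0. ?v p) = (\<Prod>p\<in>row 0. w p)"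
    proof (rule prod.cong[OF refl])
      fix p assume "p \<in> row 0"
      then have "p \<in> T 0" using full[of 0] by simp
      then show "?v p = w p" using v[of p] T0 by auto
    qed
    also have "(\<Prod>p\<in>row (\<tau> 0). ?v p) = (\<Prod>p\<in>row (\<tau> 0). w p)"
    proof (rule prod.cong[OF refl])
      fix p assume p: "p \<in> row (\<tau> 0)"
      have "\<pi> p \<in> T 0" using \<tau>(3)[of 0 p] p by simp
      then have "?v (\<pi> p) = w (\<pi> p)" using v[of "\<pi> p"] T0 by auto
      moreover obtain b where "\<forall>w\<in>W. w p = b * w (\<pi> p)"
        using scaled[of "\<tau> 0" p] \<tau>(1,2)[of 0] p by auto
      then have "?v p = b * ?v (\<pi> p)" "w p = b * w (\<pi> p)" using vW wW by blast+
      ultimately show "?v p = w p" by simp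
    qed
    finally show ?thesis using zero_row[OF vW] by simp
  qed
  then show ?thesis using \<tau>(1,2)[of 0] by (intro exI[of _ "\<tau> 0"]) auto
qed

text \<open>Let \<open>t\<close> be the number of nonempty blocks. Property C for
  \<open>m = r - t\<close> yields two of the first \<open>m + 1\<close> blocks of total size at most
  \<open>d + 1\<close>, which bounds the basis; only the case of five rows escapes the arithmetic.
  For even \<open>r\<close>, the condition on \<open>T (r div 2)\<close> excludes the extremal
  planes, where exactly half of the blocks are nonempty.\<close>

lemma large_basis_contradiction:
  assumes d: "d \<ge> 3" and cond: "even d \<or> (even r \<and> d \<ge> r) \<or> (odd r \<and> r \<le> 5)"
    and C: "\<And>m. m \<le> (r - 1) div 2 \<Longrightarrow> property_C TYPE('k) d m"
    and large: "(odd r \<and> card basis \<ge> ((r - 1) div 2) * d + 2) \<or>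
      (even r \<and> card basis \<ge> (r div 2) * d \<and> T (r div 2) \<noteq> {} \<and> r > 0)"
  shows False
proof -
  obtain t where t: "t \<le> r" "\<And>i. i < t \<Longrightarrow> T i \<noteq> {}" "\<And>i. t \<le> i \<Longrightarrow> i < r \<Longrightarrow> T i = {}"
    using nonempty_rows by blast
  have D: "card basis = (\<Sum>i<t. card (T i))"
    unfolding card_basis using t(1,3) by (intro sum.mono_neutral_right) auto
  also have "\<dots> \<le> t * d"
    using sum_bounded_above[of "{..<t}" "\<lambda>i. card (T i)" d] card_T_le t(1) by simp
  finally have Dt: "card basis \<le> t * d" .
  \<comment> \<open>For odd \<open>r\<close> the size of the basis requires more than
    \<open>(r - 1) div 2\<close> blocks; for even \<open>r\<close> the block numbered
    \<open>r div 2\<close> is nonempty by assumption.\<close>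
  have rt: "r < 2 * t"
  proof (cases "odd r")
    case True
    then have "(r - 1) div 2 * d < t * d" using large Dt by linarith
    then have "(r - 1) div 2 < t" by simp
    with True show ?thesis by presburger
  next
    case False
    then have "r div 2 < t" using large t(3)[of "r div 2"] by (cases "r div 2 < t") auto
    with False show ?thesis by presburger
  qed
  then have m: "r - t \<le> (r - 1) div 2" by linarith
  have "\<not> (\<forall>i j. i < j \<longrightarrow> j < Suc (r - t) \<longrightarrow> card (T i) + card (T j) \<ge> d + 2)"
  proof
    assume "\<forall>i j. i < j \<longrightarrow> j < Suc (r - t) \<longrightarrow> card (T i) + card (T j) \<ge> d + 2"
    then show False
      using rt by (intro property_C_contradiction[OF C[OF m] t(1) _ t(2)]) auto
  qed
  then obtain i j where ij: "i < j" "j < Suc (r - t)" "card (T i) + card (T j) < d + 2"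
    by (auto simp: not_le)
  then obtain u where u: "r - t = Suc u" by (cases "r - t") auto
  have u2: "u + 2 \<le> t" using u rt by linarith
  have ru: "r = t + u + 1" using u by linarith
  \<comment> \<open>The sizes decrease, so the last two of the first \<open>m + 1\<close> blocks,
    numbered \<open>u\<close> and \<open>Suc u = m\<close>, are a pair of smallest total.\<close>
  have "card (T u) \<le> card (T i)" "card (T (Suc u)) \<le> card (T j)"
    using ij u u2 t(1) by (auto intro!: T_antimono)
  then have pair: "card (T u) + card (T (Suc u)) \<le> d + 1" using ij(3) by linarith
  have "card basis \<le> u * d + (d + 1) + (t - (u + 2)) * ((d + 1) div 2)"
    unfolding D
  proof (rule sum_antimono_bound[OF _ _ u2 pair])
    show "card (T j) \<le> card (T i)" if "i \<le> j" "j < t" for i j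
      using that t(1) by (intro T_antimono) auto
    show "card (T i) \<le> d" if "i < t" for i
      using that t(1) by (intro card_T_le) auto
  qed
  moreover have "(odd r \<and> card basis \<ge> ((r - 1) div 2) * d + 2) \<or>
      (even r \<and> card basis \<ge> (r div 2) * d)"
    using large by blast
  ultimately have *: "r = 5" "t = 4" "u = 0" "card basis = 2 * d + 2"
    using small_basis_arith[OF _ u2 ru d cond] by blast+
  have sum4: "card (T 0) + card (T 1) + card (T 2) + card (T 3) = 2 * d + 2"
    unfolding *(4)[symmetric] D *(2) by (simp add: eval_nat_numeral)
  have anti: "card (T 1) \<le> card (T 0)" "card (T 2) \<le> card (T 1)" "card (T 3) \<le> card (T 2)"
    using *(1) by (auto intro!: T_antimono)
  have "card (T 0) + card (T 1) \<le> d + 1" using pair *(3) by simp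
  \<comment> \<open>The first two blocks have total at most \<open>d + 1\<close>, the last two no
    more than the first two, and all four have \<open>2 d + 2\<close>; monotonicity then forces
    equality throughout.\<close>
  with sum4 anti have eq: "card (T 1) = card (T 0)" "card (T 2) = card (T 0)" "card (T 3) = card (T 0)"
    by linarith+
  show False
  proof (rule five_rows_contradiction[OF *(1)])
    show "card (T i) = card (T 0)" if "i < 4" for i
      using that eq by (auto simp: numeral_eq_Suc less_Suc_eq)
    show "card (T 0) \<ge> 2" using sum4 eq d by linarith
  qed
qed

end

section \<open>From planes to subspaces\<close>

context greedy_basis
begin

text \<open>The block numbered \<open>r div 2\<close> must be empty by the preceding contradiction.
  The \<open>r div 2\<close> blocks before it have size at most \<open>d\<close>, so they reach the
  required total only if all are full rows.\<close>

lemma even_rows_extremal: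
  assumes r: "even r" "r \<ge> 2" and d: "d \<ge> 3" and cond: "even d \<or> d \<ge> r"
    and C: "\<And>m. m \<le> (r - 1) div 2 \<Longrightarrow> property_C TYPE('k) d m"
    and large: "card basis \<ge> (r div 2) * d"
  shows "card basis = (r div 2) * d"
    and "\<exists>b. 0 < b \<and> b < r \<and> (\<forall>w\<in>W. (\<Prod>p\<in>row 0. w p) + (\<Prod>p\<in>row b. w p) = 0)"
proof -
  define h where "h = r div 2"
  have h: "r = 2 * h" "0 < h" "h < r" using r by (auto simp: h_def)
  have "T h = {}"
  proof (rule ccontr)
    assume "T h \<noteq> {}"
    then show False
      using large_basis_contradiction[OF d _ C] cond r large by (auto simp: h_def)
  qed
  have empty: "T i = {}" if "h \<le> i" "i < r" for i
    using T_antimono[OF that] \<open>T h = {}\<close> finite_T[OF that(2)] by simp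
  have D: "card basis = (\<Sum>i<h. card (T i))"
    unfolding card_basis using h(3) empty by (intro sum.mono_neutral_right) auto
  have le: "card (T i) \<le> d" if "i < h" for i using card_T_le that h by simp
  have "card basis \<le> h * d"
    unfolding D using sum_bounded_above[of "{..<h}" "\<lambda>i. card (T i)" d] le by simp
  with large show eq: "card basis = (r div 2) * d" by (simp add: h_def)
  \<comment> \<open>The deficits are natural numbers with sum 0, hence all 0.\<close>
  have "(\<Sum>i<h. d - card (T i)) = (\<Sum>i<h. d) - (\<Sum>i<h. card (T i))"
    by (rule sum_subtractf_nat) (use le in auto)
  also have "\<dots> = 0" using eq D by (simp add: h_def)
  finally have ge: "d \<le> card (T i)" if "i < h" for i
    using that by simp
  have full: "T i = row i" if "i < h" for i
  proof (rule card_subset_eq[OF finite_row])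
    show "T i \<subseteq> row i" using that h by (intro T_row) simp
    show "card (T i) = card (row i)" using le[OF that] ge[OF that] by simp
  qed
  obtain m where m: "h = Suc m" using h(2) by (cases h) auto
  have "m \<le> (r - 1) div 2" using h m by simp
  then show "\<exists>b. 0 < b \<and> b < r \<and> (\<forall>w\<in>W. (\<Prod>p\<in>row 0. w p) + (\<Prod>p\<in>row b. w p) = 0)"
    using m h full empty by (intro two_rows_cancel[OF C _ d]) auto
qed

end

section \<open>Projective subspaces and their cones\<close>

lemma prod_row_eq: "(\<Prod>p\<in>{i} \<times> A. w p) = (\<Prod>j\<in>A. w (i, j))"
proof -
  have "{i} \<times> A = Pair i ` A" by auto
  then show ?thesis by (simp add: prod.reindex inj_on_def)
qed

text \<open>By homogeneity the equation does not depend on the representative of a point. The zero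
  vector represents no point, but satisfies the equation because \<open>d > 0\<close>.\<close>

lemma projectivize_subset_locus_iff:
  fixes W :: "(nat \<times> nat \<Rightarrow> 'k::field) set"
  assumes W: "W \<subseteq> coord_space r d" and d: "d > 0"
  shows "projectivize W \<subseteq> sum_prod_locus r d A \<longleftrightarrow> (\<forall>w\<in>W. (\<Sum>i\<in>A. \<Prod>j=1..d. w (i, j)) = 0)"
proof
  assume sub: "projectivize W \<subseteq> sum_prod_locus r d A"
  show "\<forall>w\<in>W. (\<Sum>i\<in>A. \<Prod>j=1..d. w (i, j)) = 0"
  proof
    fix w assume w: "w \<in> W"
    show "(\<Sum>i\<in>A. \<Prod>j=1..d. w (i, j)) = 0"
    proof (cases "w = 0")
      case True
      then show ?thesis using d by (simp add: zero_fun_def power_0_left)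
    next
      case False
      with w have "coord.span {w} \<in> projectivize W" unfolding projectivize_def by blast
      with sub have "coord.span {w} \<in> sum_prod_locus r d A" by blast
      then obtain x where x: "(\<Sum>i\<in>A. \<Prod>j=1..d. x (i, j)) = 0" "coord.span {w} = coord.span {x}"
        unfolding sum_prod_locus_def projectivize_def by blast
      have "w \<in> coord.span {x}"
        using coord.span_base[of w "{w}"] x(2) by simp
      then obtain a where "w = scale_fun a x" by (auto simp: coord.span_singleton)
      then have "(\<Sum>i\<in>A. \<Prod>j=1..d. w (i, j)) = a ^ d * (\<Sum>i\<in>A. \<Prod>j=1..d. x (i, j))"
        by (simp add: scale_fun_def prod.distrib sum_distrib_left)
      with x(1) show ?thesis by simp
    qed
  qed
next
  assume "\<forall>w\<in>W. (\<Sum>i\<in>A. \<Prod>j=1..d. w (i, j)) = 0"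
  with W show "projectivize W \<subseteq> sum_prod_locus r d A"
    by (auto simp: sum_prod_locus_def projectivize_def)
qed

text \<open>The blocks determine every row, and vectors of \<open>W\<close> vanish off the index
  set; so the basis determines \<open>W\<close> and bounds its dimension.\<close>

lemma greedy_basis_exists:
  fixes W :: "(nat \<times> nat \<Rightarrow> 'k::field) set"
  assumes inf: "infinite (UNIV :: 'k set)" and d: "d > 0"
    and W: "coord.subspace W" "W \<subseteq> coord_space r d"
    and zero: "\<forall>w\<in>W. (\<Sum>i=1..r. \<Prod>j=1..d. w (i, j)) = 0"
    and nonzero: "\<forall>i\<in>{1..r}. \<exists>w\<in>W. (\<Prod>j=1..d. w (i, j)) \<noteq> 0"
  shows "\<exists>g T. greedy_basis W r d g T \<and> coord.dim W \<le> card (\<Union>i<r. T i)"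
proof -
  have R: "finite {1..r}" "\<forall>i\<in>{1..r}. finite ({i} \<times> {1..d})" "r = card {1..r}" by auto
  have ind: "coord_indep W {}"
    using coord.subspace_0[OF W(1)] by (auto simp: coord_indep_def)
  have mono: "\<forall>A B. coord_indep W B \<longrightarrow> A \<subseteq> B \<longrightarrow> coord_indep W A"
    by (blast intro: coord_indep_mono)
  obtain g T where gT: "bij_betw g {..<r} {1..r}" "\<forall>i<r. T i \<subseteq> {g i} \<times> {1..d}"
    "coord_indep W (\<Union>i<r. T i)"
    "\<forall>i j. i \<le> j \<longrightarrow> j < r \<longrightarrow> card (T j) \<le> card (T i)"
    "\<forall>i j T'. i \<le> j \<longrightarrow> j < r \<longrightarrow> T' \<subseteq> {g j} \<times> {1..d} \<longrightarrow>
      coord_indep W ((\<Union>k<i. T k) \<union> T') \<longrightarrow> card T' \<le> card (T i)"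
    using greedy[of "coord_indep W", OF ind mono R] by (elim exE conjE)
  interpret greedy_basis W r d g T
  proof
    show "(\<Sum>i<r. \<Prod>p\<in>{g i} \<times> {1..d}. w p) = 0" if "w \<in> W" for w
      using sum.reindex_bij_betw[OF gT(1), of "\<lambda>i. \<Prod>j=1..d. w (i, j)"] zero that
      by (simp add: prod_row_eq)
    show "\<exists>w\<in>W. w p \<noteq> 0" if "p \<in> {1..r} \<times> {1..d}" for p
    proof -
      obtain i j where p: "p = (i, j)" "i \<in> {1..r}" "j \<in> {1..d}"
        using \<open>p \<in> {1..r} \<times> {1..d}\<close> by blast
      then obtain w where "w \<in> W" "(\<Prod>j=1..d. w (i, j)) \<noteq> 0" using nonzero by blast
      then show ?thesis using p by auto
    qed
  qed (fact inf d W(1) gT[rule_format])+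
  have "coord.dim W \<le> card basis"
  proof (rule dim_le_card_determining[OF W(1) finite_basis])
    show "coord_indep W basis" unfolding basis_def by (rule indep)
    show "w = 0" if w: "w \<in> W" "\<forall>q\<in>basis. w q = 0" for w
    proof (rule ext)
      fix p
      show "w p = 0 p"
      proof (cases "p \<in> {1..r} \<times> {1..d}")
        case True
        then have "fst p \<in> g ` {..<r}" using bij_betw_imp_surj_on[OF g] by auto
        then obtain i where i: "i < r" "fst p = g i" by auto
        then have "p \<in> row i" using True by (auto simp: row_def)
        then have "w p = 0"
          using determined[OF i(1) _ w(1)] w(2) T_basis i(1) by (meson le_less_trans subsetD)
        then show ?thesis by simp
      next
        case False
        then have "w p = 0" using W(2) w(1) unfolding coord_space_def by blast
        then show ?thesis by simp
      qed
    qed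
  qed
  then show ?thesis
    using greedy_basis_axioms unfolding basis_def by blast
qed

lemma admits_splitting_card:
  assumes "W \<subseteq> coord_space r d" "d > 0" "A \<subseteq> {1..r}" "A \<noteq> {}"
    and "\<forall>w\<in>W. (\<Sum>i\<in>A. \<Prod>j=1..d. w (i, j)) = 0"
  shows "admits_splitting r d (card A) (projectivize W)"
  using assms finite_subset[OF assms(3)]
  by (auto simp: admits_splitting_def projectivize_subset_locus_iff card_gt_0_iff Suc_le_eq)

lemma not_one_split_greedy_basis:
  fixes L :: "(nat \<times> nat \<Rightarrow> 'k::field) set set"
  assumes inf: "infinite (UNIV :: 'k set)" and d: "d > 0"
    and L: "L \<in> fano_planes r d k" and not: "\<not> admits_splitting r d 1 L"
  shows "\<exists>W g T. L = projectivize W \<and> W \<subseteq> coord_space r d \<and> greedy_basis W r d g T \<and> k + 1 \<le> card (\<Union>i<r. T i)"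
proof -
  obtain W where W: "W \<subseteq> coord_space r d" "coord.subspace W" "coord.dim W = k + 1" "L = projectivize W"
    and X: "L \<subseteq> sum_prod_locus r d {1..r}"
    using L unfolding fano_planes_def proj_plane_def X_hyp_def by blast
  have "\<forall>w\<in>W. (\<Sum>i=1..r. \<Prod>j=1..d. w (i, j)) = 0"
    using X W projectivize_subset_locus_iff[OF W(1) d] by simp
  moreover have "\<forall>i\<in>{1..r}. \<exists>w\<in>W. (\<Prod>j=1..d. w (i, j)) \<noteq> 0"
    using admits_splitting_card[OF W(1) d, of "{i}" for i] not W(4) by fastforce
  ultimately show ?thesis
    using greedy_basis_exists[OF inf d W(2,1)] W by fastforce
qed

section \<open>Planes that are not one-split\<close>

text \<open>Extend \<open>w\<close> to a basis of the span of \<open>w\<close> and the vectors dual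
  to \<open>F\<close>. It has at least \<open>card F\<close> elements, and any \<open>n\<close> of
  them that include \<open>w\<close> span a suitable space.\<close>

lemma ex_subspace_of_dim:
  fixes W :: "('i \<Rightarrow> 'k::field) set"
  assumes W: "coord.subspace W" and F: "finite F" "coord_indep W F"
    and w: "w \<in> W" "w \<noteq> 0" and n: "0 < n" "n \<le> card F"
  shows "\<exists>V\<subseteq>W. coord.subspace V \<and> coord.dim V = n \<and> w \<in> V"
proof -
  obtain u where u: "\<forall>q\<in>F. u q \<in> W \<and> (\<forall>q'\<in>F. u q q' = (if q' = q then 1 else 0))"
    using coord_indep_dual_basis[OF F(2)] by blast
  define E where "E = u ` F"
  have inj: "inj_on u F"
  proof (rule inj_onI)
    fix q q' assume qq': "q \<in> F" "q' \<in> F" "u q = u q'"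
    then have "u q' q = 1" using u by metis
    then show "q = q'" using u qq' by (metis zero_neq_one)
  qed
  have "u q \<notin> coord.span (E - {u q})" if q: "q \<in> F" for q
  proof
    assume "u q \<in> coord.span (E - {u q})"
    \<comment> \<open>The coordinate \<open>q\<close> separates \<open>u q\<close> from the other
      dual vectors.\<close>
    also have "coord.span (E - {u q}) \<subseteq> {v. v q = 0}"
    proof (rule coord.span_minimal)
      show "E - {u q} \<subseteq> {v. v q = 0}" using u q by (auto simp: E_def)
      show "coord.subspace {v :: 'i \<Rightarrow> 'k. v q = 0}"
        by (auto simp: coord.subspace_def scale_fun_def)
    qed
    finally show False using u q by auto
  qed
  then have indE: "coord.independent E"
    unfolding coord.dependent_def by (auto simp: E_def)
  have "coord.independent {w}" using w(2) by (simp add: coord.dependent_single)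
  then obtain B where B: "{w} \<subseteq> B" "B \<subseteq> insert w E" "coord.independent B" "insert w E \<subseteq> coord.span B"
    using coord.maximal_independent_subset_extend[of "{w}" "insert w E"] by blast
  have finB: "finite B" using B(2) F(1) by (auto simp: E_def intro: finite_subset)
  have "card E \<le> card B"
    using coord.independent_span_bound[OF finB indE] B(4) by blast
  then have "n \<le> card B" using n card_image[OF inj] by (simp add: E_def)
  then have "n - 1 \<le> card (B - {w})" using B(1) finB by simp
  then obtain C where C: "C \<subseteq> B - {w}" "card C = n - 1" "finite C"
    by (rule obtain_subset_with_card_n)
  have Cw: "insert w C \<subseteq> B" "card (insert w C) = n"
    using C B(1) n(1) by (auto simp: card_insert_if)
  have BW: "B \<subseteq> W" using B(2) w(1) u by (auto simp: E_def)
  let ?V = "coord.span (insert w C)"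
  have "?V \<subseteq> W" using Cw BW W by (intro coord.span_minimal) auto
  moreover have "coord.dim ?V = n"
    using coord.dim_span_eq_card_independent[OF coord.independent_mono[OF B(3) Cw(1)]] Cw(2) by simp
  moreover have "w \<in> ?V" by (intro coord.span_base) simp
  ultimately show ?thesis using coord.subspace_span by blast
qed

text \<open>A subspace through a vector without zero coordinates lies in no \<open>V\<close> of a
  single row product, and \<open>F\<close> leaves room for one of dimension
  \<open>k + 1\<close>.\<close>

lemma not_one_split_if_subspace:
  fixes W :: "(nat \<times> nat \<Rightarrow> 'k::field) set"
  assumes W: "coord.subspace W" "W \<subseteq> coord_space r d" and r: "r > 0" and d: "d > 0"
    and zero: "\<And>w. w \<in> W \<Longrightarrow> (\<Sum>i=1..r. \<Prod>j=1..d. w (i, j)) = 0"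
    and F: "finite F" "coord_indep W F"
    and w: "w \<in> W" "\<And>i j. i \<in> {1..r} \<Longrightarrow> j \<in> {1..d} \<Longrightarrow> w (i, j) \<noteq> 0"
    and k: "k < card F"
  shows "\<not> fano_split TYPE('k) r d k 1"
proof
  assume split: "fano_split TYPE('k) r d k 1"
  have "w (1, 1) \<noteq> 0" using w(2)[of 1 1] r d by auto
  then have "w \<noteq> 0" by auto
  then obtain V where V: "V \<subseteq> W" "coord.subspace V" "coord.dim V = k + 1" "w \<in> V"
    using ex_subspace_of_dim[OF W(1) F w(1), of "k + 1"] k by auto
  have VC: "V \<subseteq> coord_space r d" using V(1) W(2) by blast
  have "projectivize V \<subseteq> X_hyp r d"
    unfolding X_hyp_def projectivize_subset_locus_iff[OF VC d] using zero V(1) by blast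
  then have "projectivize V \<in> fano_planes r d k"
    unfolding fano_planes_def proj_plane_def using V(2,3) VC by blast
  then obtain l where "l \<le> 1" "admits_splitting r d l (projectivize V)"
    using split unfolding fano_split_def by blast
  then obtain A where A: "A \<subseteq> {1..r}" "card A = 1" "projectivize V \<subseteq> sum_prod_locus r d A"
    unfolding admits_splitting_def by (metis le_antisym)
  then obtain i where i: "A = {i}" "i \<in> {1..r}"
    by (metis card_1_singletonE insert_subset)
  have "(\<Prod>j=1..d. w (i, j)) = 0"
    using A(3) V(4) unfolding projectivize_subset_locus_iff[OF VC d] i by simp
  then show False using w(2)[OF i(2)] by (auto simp: prod_zero_iff)
qed

section \<open>Explicit linear spaces showing that the bounds are sharp\<close>

definition pair_sign :: "nat \<Rightarrow> 'k::field"
  where "pair_sign j = (if j = 1 then - 1 else 1)"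

text \<open>Only the first coordinate changes its sign, so the two products cancel for every parity
  of \<open>d\<close>.\<close>

definition paired_rows :: "nat \<Rightarrow> nat \<Rightarrow> (nat \<times> nat \<Rightarrow> 'k::field) set"
  where "paired_rows h d = {x. \<forall>a<h. \<forall>j\<in>{1..d}. x (2 * a + 2, j) = pair_sign j * x (2 * a + 1, j)}"

text \<open>These are the coordinates that can be prescribed freely in
  \<open>paired_rows\<close>.\<close>

definition odd_rows :: "nat \<Rightarrow> nat \<Rightarrow> (nat \<times> nat) set"
  where "odd_rows h d = (\<lambda>(a, j). (2 * a + 1, j)) ` ({..<h} \<times> {1..d})"

lemma card_odd_rows: "card (odd_rows h d) = h * d"
  unfolding odd_rows_def by (subst card_image) (auto simp: inj_on_def)

lemma finite_odd_rows: "finite (odd_rows h d)"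
  by (simp add: odd_rows_def)

lemma prod_split_first: "d > 0 \<Longrightarrow> (\<Prod>j=1..d. f j) = f 1 * (\<Prod>j=2..d. f j)" for f :: "nat \<Rightarrow> 'a::comm_monoid_mult"
  by (subst prod.atLeast_Suc_atMost) (auto simp: numeral_2_eq_2)

lemma prod_pair_sign: "d > 0 \<Longrightarrow> (\<Prod>j=1..d. pair_sign j) = (- 1 :: 'k::field)"
  by (simp only: prod_split_first) (simp add: pair_sign_def)

lemma sum_paired_rows:
  assumes "x \<in> paired_rows h d" "d > 0"
  shows "(\<Sum>i=1..2*h. \<Prod>j=1..d. x (i, j)) = (0 :: 'k::field)"
  using assms(1)
proof (induction h)
  case 0
  then show ?case by simp
next
  case (Suc h)
  then have "x \<in> paired_rows h d" by (simp add: paired_rows_def)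
  moreover have "(\<Prod>j=1..d. x (2 * h + 2, j)) = (\<Prod>j=1..d. pair_sign j * x (2 * h + 1, j))"
    using Suc.prems by (intro prod.cong) (auto simp: paired_rows_def)
  then have "(\<Prod>j=1..d. x (2 * h + 2, j)) = - (\<Prod>j=1..d. x (2 * h + 1, j))"
    using assms(2) by (simp only: prod.distrib prod_pair_sign) simp
  ultimately show ?case using Suc.IH by simp
qed

lemma even_not_one_split:
  assumes r: "r = 2 * h" "h > 0" and d: "d > 0" and k: "k < h * d"
  shows "\<not> fano_split TYPE('k::field) r d k 1"
proof (rule not_one_split_if_subspace)
  let ?W = "coord_space r d \<inter> paired_rows h d :: (nat \<times> nat \<Rightarrow> 'k) set"
  show "coord.subspace ?W"
    by (auto simp: coord.subspace_def coord_space_def paired_rows_def scale_fun_def algebra_simps)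
  show "(\<Sum>i=1..r. \<Prod>j=1..d. w (i, j)) = 0" if "w \<in> ?W" for w
    using that sum_paired_rows d r by blast
  show "coord_indep ?W (odd_rows h d)"
    unfolding coord_indep_def
  proof
    fix c :: "nat \<times> nat \<Rightarrow> 'k"
    let ?w = "\<lambda>(i, j). if (i, j) \<in> {1..r} \<times> {1..d} then
      (if odd i then c (i, j) else pair_sign j * c (i - 1, j)) else 0"
    show "\<exists>w\<in>?W. \<forall>q\<in>odd_rows h d. w q = c q"
      using r by (intro bexI[of _ ?w]) (auto simp: odd_rows_def coord_space_def paired_rows_def)
  qed
  let ?w = "\<lambda>(i, j). if (i, j) \<in> {1..r} \<times> {1..d} then
      (if odd i then 1 else pair_sign j :: 'k) else 0"
  show "?w \<in> ?W" using r by (auto simp: coord_space_def paired_rows_def)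
  show "?w (i, j) \<noteq> 0" if "i \<in> {1..r}" "j \<in> {1..d}" for i j
    using that by (auto simp: pair_sign_def)
qed (use r d k in \<open>auto simp: finite_odd_rows card_odd_rows\<close>)

text \<open>Besides \<open>h\<close> cancelling pairs there is a triple of rows that agree in all
  coordinates but the first, where the sum is 0. The triple has \<open>d + 1\<close> free
  coordinates, which gives \<open>(h + 1) d + 1\<close> in total.\<close>

lemma odd_not_one_split:
  assumes inf: "infinite (UNIV :: 'k::field set)"
    and r: "r = 2 * h + 3" and d: "d > 0" and k: "k \<le> (h + 1) * d"
  shows "\<not> fano_split TYPE('k) r d k 1"
proof -
  \<comment> \<open>The first coordinates of the triple will be 1, \<open>z\<close> and
    \<open>- 1 - z\<close>, all nonzero.\<close>
  obtain z :: 'k where z: "z \<notin> {0, - 1}" using ex_new_if_finite[OF inf, of "{0, - 1}"] by auto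
  show ?thesis
  proof (rule not_one_split_if_subspace)
    let ?T = "{x. x (2 * h + 3, 1) = - x (2 * h + 1, 1) - x (2 * h + 2, 1) \<and>
      (\<forall>j\<in>{2..d}. x (2 * h + 2, j) = x (2 * h + 1, j) \<and> x (2 * h + 3, j) = x (2 * h + 1, j))}
      :: (nat \<times> nat \<Rightarrow> 'k) set"
    let ?W = "coord_space r d \<inter> paired_rows h d \<inter> ?T"
    let ?F = "insert (2 * h + 2, 1) (odd_rows (Suc h) d)"
    \<comment> \<open>The vector of \<open>?W\<close> with prescribed values \<open>c\<close> at the
      free coordinates \<open>?F\<close>.\<close>
    let ?v = "\<lambda>(c :: nat \<times> nat \<Rightarrow> 'k) (i, j). if (i, j) \<in> {1..r} \<times> {1..d} then
        (if i \<le> 2 * h then (if odd i then c (i, j) else pair_sign j * c (i - 1, j))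
         else if j = 1 \<and> i = 2 * h + 2 then c (i, j)
         else if j = 1 \<and> i = 2 * h + 3 then - c (2 * h + 1, 1) - c (2 * h + 2, 1)
         else c (2 * h + 1, j)) else 0"
    have v: "?v c \<in> ?W" for c
      using r d by (auto simp: coord_space_def paired_rows_def)
    show "coord.subspace ?W"
      by (auto simp: coord.subspace_def coord_space_def paired_rows_def scale_fun_def algebra_simps)
        (metis distrib_left mult_minus_right)
    show "(\<Sum>i=1..r. \<Prod>j=1..d. w (i, j)) = 0" if w: "w \<in> ?W" for w
    proof -
      have "(\<Prod>j=2..d. w (2 * h + 2, j)) = (\<Prod>j=2..d. w (2 * h + 1, j))"
        "(\<Prod>j=2..d. w (2 * h + 3, j)) = (\<Prod>j=2..d. w (2 * h + 1, j))"
        using w by (auto intro!: prod.cong)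
      then have "(\<Prod>j=1..d. w (2 * h + 1, j)) + (\<Prod>j=1..d. w (2 * h + 2, j)) + (\<Prod>j=1..d. w (2 * h + 3, j))
        = (w (2 * h + 1, 1) + w (2 * h + 2, 1) + w (2 * h + 3, 1)) * (\<Prod>j=2..d. w (2 * h + 1, j))"
        by (simp only: prod_split_first[OF d]) (simp add: algebra_simps)
      also have "\<dots> = 0" using w by simp
      finally show ?thesis
        using sum_paired_rows[of w h d] w d by (simp add: r eval_nat_numeral add.assoc)
    qed
    show "coord_indep ?W ?F"
      unfolding coord_indep_def
    proof
      fix c :: "nat \<times> nat \<Rightarrow> 'k"
      show "\<exists>w\<in>?W. \<forall>q\<in>?F. w q = c q"
      proof (intro bexI[OF _ v[of c]] ballI)
        fix q assume "q \<in> ?F"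
        then show "?v c q = c q" using r d by (auto simp: odd_rows_def less_Suc_eq)
      qed
    qed
    have "(2 * h + 2, 1) \<notin> odd_rows (Suc h) d" by (auto simp: odd_rows_def)
    then show "k < card ?F"
      using k by (simp add: finite_odd_rows card_odd_rows)
    let ?c = "\<lambda>q. if q = (2 * h + 2, 1) then z else 1"
    show "?v ?c \<in> ?W" by (rule v)
    show "?v ?c (i, j) \<noteq> 0" if "i \<in> {1..r}" "j \<in> {1..d}" for i j
      using that z by (auto simp: pair_sign_def eq_neg_iff_add_eq_0 diff_eq_eq)
  qed (use r d in \<open>auto simp: finite_odd_rows\<close>)
qed

theorem theorem1p7:
  fixes r d k :: nat
  assumes "r \<ge> 2" and "d \<ge> 3"
    and "even d \<or> (even r \<and> d \<ge> r) \<or> (odd r \<and> r \<le> 5)"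
    and "\<forall>m. m \<le> (r - 1) div 2 \<longrightarrow> property_C TYPE('K::alg_closed_field) d m"
  shows
    "(even r \<longrightarrow> (fano_split TYPE('K) r d k 1 \<longleftrightarrow> k \<ge> (r div 2) * d)) \<and>
     (odd r \<longrightarrow> (fano_split TYPE('K) r d k 1 \<longleftrightarrow> k \<ge> ((r - 1) div 2) * d + 1)) \<and>
     (even r \<and> k \<ge> (r div 2) * d - 1 \<longrightarrow> fano_split TYPE('K) r d k 2)"
proof (intro conjI impI)
  note inf = infinite_alg_closed_field[where 'k = 'K]
  have d: "d > 0" using assms(2) by simp
  note C = assms(4)[rule_format]
  have half: "(r div 2) * d > 0" using assms(1) d by simp
  show "fano_split TYPE('K) r d k 1 \<longleftrightarrow> k \<ge> (r div 2) * d" if "even r"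
  proof
    assume "fano_split TYPE('K) r d k 1"
    then show "k \<ge> (r div 2) * d"
      using even_not_one_split[where 'k = 'K, of r "r div 2" d k] that assms(1) d by force
  next
    assume k: "k \<ge> (r div 2) * d"
    have "admits_splitting r d 1 L" if L: "L \<in> fano_planes r d k" for L :: "(nat \<times> nat \<Rightarrow> 'K) set set"
    proof (rule ccontr)
      assume "\<not> admits_splitting r d 1 L"
      from not_one_split_greedy_basis[OF inf d L this] obtain W g T
        where "L = projectivize W" "W \<subseteq> coord_space r d"
          and W: "greedy_basis W r d g T" "k + 1 \<le> card (\<Union>i<r. T i)"
        by (elim exE conjE)
      interpret greedy_basis W r d g T by (rule W(1))
      \<comment> \<open>This is less than \<open>k + 1\<close>, which the basis must reach.\<close>
      have "card basis = (r div 2) * d"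
        using even_rows_extremal(1)[OF \<open>even r\<close> assms(1,2) _ C] assms(3) W(2) k \<open>even r\<close>
        by (auto simp: basis_def)
      with W(2) k show False by (simp add: basis_def)
    qed
    then show "fano_split TYPE('K) r d k 1"
      unfolding fano_split_def by blast
  qed
  show "fano_split TYPE('K) r d k 1 \<longleftrightarrow> k \<ge> ((r - 1) div 2) * d + 1" if "odd r"
  proof
    assume split: "fano_split TYPE('K) r d k 1"
    \<comment> \<open>An odd \<open>r >= 2\<close> is at least 3, so the subtraction is
      exact.\<close>
    define h where "h = (r - 3) div 2"
    have h: "r = 2 * h + 3"
      unfolding h_def using that assms(1) by presburger
    then show "k \<ge> ((r - 1) div 2) * d + 1"
      using odd_not_one_split[OF inf h d, of k] split by force
  next
    assume k: "k \<ge> ((r - 1) div 2) * d + 1"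
    have "admits_splitting r d 1 L" if L: "L \<in> fano_planes r d k" for L :: "(nat \<times> nat \<Rightarrow> 'K) set set"
    proof (rule ccontr)
      assume "\<not> admits_splitting r d 1 L"
      from not_one_split_greedy_basis[OF inf d L this] obtain W g T
        where "L = projectivize W" "W \<subseteq> coord_space r d"
          and W: "greedy_basis W r d g T" "k + 1 \<le> card (\<Union>i<r. T i)"
        by (elim exE conjE)
      interpret greedy_basis W r d g T by (rule W(1))
      show False
        using large_basis_contradiction[OF assms(2,3) C] \<open>odd r\<close> W(2) k by (auto simp: basis_def)
    qed
    then show "fano_split TYPE('K) r d k 1"
      unfolding fano_split_def by blast
  qed
  show "fano_split TYPE('K) r d k 2" if "even r \<and> k \<ge> (r div 2) * d - 1"
    unfolding fano_split_def
  proof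
    fix L :: "(nat \<times> nat \<Rightarrow> 'K) set set"
    assume L: "L \<in> fano_planes r d k"
    have even: "even r" and k: "k + 1 \<ge> (r div 2) * d" using that by auto
    show "\<exists>l\<le>2. admits_splitting r d l L"
    proof (cases "admits_splitting r d 1 L")
      case True
      then show ?thesis by (intro exI[of _ 1]) simp
    next
      case False
      from not_one_split_greedy_basis[OF inf d L this] obtain W g T
        where W: "L = projectivize W" "W \<subseteq> coord_space r d"
          "greedy_basis W r d g T" "k + 1 \<le> card (\<Union>i<r. T i)"
        by (elim exE conjE)
      interpret greedy_basis W r d g T by (rule W(3))
      \<comment> \<open>The basis has at least \<open>(r div 2) d\<close> elements, so the extremal
        case applies; \<open>g\<close> translates the cancelling rows 0 and \<open>b\<close> into
        the two indices of the splitting.\<close>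
      obtain b where b: "0 < b" "b < r" "\<forall>w\<in>W. (\<Prod>p\<in>row 0. w p) + (\<Prod>p\<in>row b. w p) = 0"
        using even_rows_extremal(2)[OF even assms(1,2) _ C] assms(3) W(4) k even
        by (auto simp: basis_def)
      have "g 0 \<noteq> g b"
        using inj_onD[OF bij_betw_imp_inj_on[OF g], of 0 b] b(1,2) by auto
      moreover have "{g 0, g b} \<subseteq> {1..r}"
        using bij_betw_imp_surj_on[OF g] b(1,2) by auto
      ultimately have "admits_splitting r d (card {g 0, g b}) (projectivize W)"
        using b(3) by (intro admits_splitting_card[OF W(2) d]) (auto simp: row_def prod_row_eq)
      with \<open>g 0 \<noteq> g b\<close> W(1) show ?thesis
        by (intro exI[of _ 2]) (simp add: numeral_2_eq_2)
    qed
  qed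
qed

end
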